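(* Let $w$ be an arbitrary positive weight function on the edges of the lattice $\mathbb Z_+^2$, and let $\mathrm{ext}^\circ\mathcal P$ be the set of measures in $\mathcal P=\mathcal P(w)$ induced by regular paths. Then $\mathrm{ext}^\circ\mathcal P$ is weakly compact, and the map $P\mapsto \pi(P):=P(H_1=1)$ is a homeomorphism of $\mathrm{ext}^\circ\mathcal P$ (with the weak topology) onto a subset of $[0,1]$.
   Context: Consider the lattice $\mathbb Z_+^2$ with directed edges $(h,t)\to(h+1,t)$ and $(h,t)\to(h,t+1)$, carrying strictly positive weights $w_1(h,t)$ and $w_0(h,t)$ respectively (a weighted Pascal graph). A standard path is a (finite or infinite) path starting at $(0,0)$ and moving along directed edges. The weight of a finite path is the product of the weights of its edges; $d(h,t)$ is the sum of the weights of all standard paths with endpoint $(h,t)$. $\mathcal P=\mathcal P(w)$ is the set of probability laws $P$ of random infinite standard paths $S=(S_n)_{n\ge 0}$, $S_n=(H_n,T_n)$, $H_n+T_n=n$, with the conditioning property: whenever $P(S_{h+t}=(h,t))>0$, given $S_{h+t}=(h,t)$ the conditional probability of each standard path with endpoint $(h,t)$ (as the initial segment of $S$) is the weight of that path divided by $d(h,t)$. The weak topology on laws of infinite standard paths is the topology of convergence of the probability of each finite initial path segment. For $(h,t)\in\mathbb Z_+^2$ the elementary measure $Q_{h,t}$ is the probability measure on standard paths with endpoint $(h,t)$ assigning to each such path its weight divided by $d(h,t)$. An infinite standard path $(h_n,t_n)_{n\ge0}$ is regular if the elementary measures $Q_{h_n,t_n}$ converge weakly as $n\to\infty$, i.e.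 for every finite standard path $u$ the $Q_{h_n,t_n}$-probability that the path starts with $u$ converges; the limits define a measure belonging to $\mathcal P$, which is said to be induced by the path. $\mathrm{ext}^\circ\mathcal P$ is the set of measures induced by regular paths. *)

theory Defs
  imports "HOL-Probability.Probability" "HOL-Library.Sublist"
begin

section \<open>The weighted Pascal graph\<close>

type_synonym vertex = "nat \<times> nat"

definition lattice_edges :: "(vertex \<times> vertex) set" where
  "lattice_edges =
     {((h, t), (Suc h, t)) | h t. True} \<union> {((h, t), (h, Suc t)) | h t. True}"

text \<open>A finite path is the nonempty list of its vertices. A weight function is a real function
  on pairs of vertices; only its values on \<^const>\<open>lattice_edges\<close> are ever used.\<close>

definition fin_paths :: "vertex list set" where
  "fin_paths =
     {u. u \<noteq> [] \<and> hd u = (0, 0) \<and> successively (\<lambda>a b. (a, b) \<in> lattice_edges) u}"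

definition paths_to :: "vertex \<Rightarrow> vertex list set" where
  "paths_to v = {u \<in> fin_paths. last u = v}"

definition path_weight :: "(vertex \<times> vertex \<Rightarrow> real) \<Rightarrow> vertex list \<Rightarrow> real" where
  "path_weight w u = (\<Prod>i<length u - 1. w (u ! i, u ! Suc i))"

definition total_weight :: "(vertex \<times> vertex \<Rightarrow> real) \<Rightarrow> vertex \<Rightarrow> real" where
  "total_weight w v = (\<Sum>u\<in>paths_to v. path_weight w u)"

definition elementary_measure ::
    "(vertex \<times> vertex \<Rightarrow> real) \<Rightarrow> vertex \<Rightarrow> vertex list measure" where
  "elementary_measure w v =
     point_measure (paths_to v) (\<lambda>u. ennreal (path_weight w u / total_weight w v))"


section \<open>Laws of random infinite paths\<close>

definition inf_paths :: "(nat \<Rightarrow> vertex) set" where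
  "inf_paths = {s. s 0 = (0, 0) \<and> (\<forall>n. (s n, s (Suc n)) \<in> lattice_edges)}"

definition starts_with :: "(nat \<Rightarrow> vertex) \<Rightarrow> vertex list \<Rightarrow> bool" where
  "starts_with s u \<longleftrightarrow> map s [0..<length u] = u"

definition path_space :: "(nat \<Rightarrow> vertex) measure" where
  "path_space = restrict_space (\<Pi>\<^sub>M n\<in>UNIV. count_space UNIV) inf_paths"

definition path_laws :: "(nat \<Rightarrow> vertex) measure set" where
  "path_laws = {P. prob_space P \<and> sets P = sets path_space}"

text \<open>The initial topology on \<^const>\<open>path_laws\<close> for the maps sending \<open>P\<close> to
  the probability that the random path starts with \<open>u\<close>, where \<open>u\<close> ranges over
  \<^const>\<open>fin_paths\<close>.\<close>

definition weak_topology :: "(nat \<Rightarrow> vertex) measure topology" where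
  "weak_topology =
     pullback_topology path_laws
       (\<lambda>P. \<lambda>u\<in>fin_paths. \<P>(s in P. starts_with s u))
       (product_topology (\<lambda>_. euclideanreal) fin_paths)"

definition conditioned_laws ::
    "(vertex \<times> vertex \<Rightarrow> real) \<Rightarrow> (nat \<Rightarrow> vertex) measure set" where
  "conditioned_laws w =
     {P \<in> path_laws. \<forall>h t. \<P>(s in P. s (h + t) = (h, t)) > 0 \<longrightarrow>
        (\<forall>u\<in>paths_to (h, t).
           \<P>(s in P. starts_with s u \<bar> s (h + t) = (h, t))
             = path_weight w u / total_weight w (h, t))}"


section \<open>Regular paths and the measures they induce\<close>

definition elementary_start_prob ::
    "(vertex \<times> vertex \<Rightarrow> real) \<Rightarrow> vertex \<Rightarrow> vertex list \<Rightarrow> real" where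
  "elementary_start_prob w v u = \<P>(p in elementary_measure w v. prefix u p)"

definition regular_path :: "(vertex \<times> vertex \<Rightarrow> real) \<Rightarrow> (nat \<Rightarrow> vertex) \<Rightarrow> bool" where
  "regular_path w s \<longleftrightarrow>
     s \<in> inf_paths \<and>
     (\<forall>u\<in>fin_paths. convergent (\<lambda>n. elementary_start_prob w (s n) u))"

definition induces ::
    "(vertex \<times> vertex \<Rightarrow> real) \<Rightarrow> (nat \<Rightarrow> vertex) \<Rightarrow> (nat \<Rightarrow> vertex) measure \<Rightarrow> bool" where
  "induces w s P \<longleftrightarrow>
     (\<forall>u\<in>fin_paths.
        (\<lambda>n. elementary_start_prob w (s n) u) \<longlonglongrightarrow> \<P>(r in P. starts_with r u))"

definition ext_circ ::
    "(vertex \<times> vertex \<Rightarrow> real) \<Rightarrow> (nat \<Rightarrow> vertex) measure set" where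
  "ext_circ w = {P \<in> conditioned_laws w. \<exists>s. regular_path w s \<and> induces w s P}"

definition first_step_prob :: "(nat \<Rightarrow> vertex) measure \<Rightarrow> real" where
  "first_step_prob P = \<P>(s in P. fst (s 1) = 1)"

end

theory Submission
  imports Defs
begin

text \<open>
  Write \<open>q v\<close> for the probability under the elementary measure of \<open>v\<close> that the first step goes
  to \<open>(1, 0)\<close>. Viewed as a function of \<open>v\<close>, the probability that the path starts with a fixed \<open>u\<close>
  is on each level a convex combination of neighbouring values on the level below, with weights
  not depending on \<open>u\<close>. Monotonicity along a level therefore propagates to all higher levels, and
  \<open>q\<close> is strictly increasing along every level. On the level where \<open>u\<close> ends, some multiple of \<open>q\<close>
  dominates the increments of the start probability of \<open>u\<close>, and by propagation it does so on all
  higher levels. In the limit, the start probabilities of measures induced by regular paths are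
  Lipschitz functions of \<open>\<pi>(P)\<close>, so that \<open>\<pi>\<close> is injective with continuous inverse.

  It remains to see that the set of values of \<open>\<pi>\<close> is closed. The values of \<open>q\<close> on consecutive
  levels interlace, so the rightmost vertices with \<open>q \<le> x\<close> form a lattice path, as do the leftmost
  vertices with \<open>q \<ge> x\<close>. If \<open>x\<close> is a limit of values of \<open>\<pi>\<close> from below (from above), then along
  the first (the second) of these paths \<open>q\<close> tends to \<open>x\<close>, and the Lipschitz bound makes the path
  regular.
\<close>

section \<open>Finite paths\<close>

lemma edge_from_iff:
  "((h, t), v) \<in> lattice_edges \<longleftrightarrow> v = (Suc h, t) \<or> v = (h, Suc t)"
  by (auto simp: lattice_edges_def)

definition preds :: "vertex \<Rightarrow> vertex set" where
  "preds v = {x. (x, v) \<in> lattice_edges}"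

lemma preds_simps [simp]:
  "preds (0, 0) = {}"
  "preds (Suc h, 0) = {(h, 0)}"
  "preds (0, Suc t) = {(0, t)}"
  "preds (Suc h, Suc t) = {(h, Suc t), (Suc h, t)}"
  by (auto simp: preds_def lattice_edges_def)

lemma finite_preds [simp]: "finite (preds v)"
  by (cases v; cases "fst v"; cases "snd v") auto

lemma level_preds: "x \<in> preds v \<Longrightarrow> fst v + snd v = Suc (fst x + snd x)"
  by (auto simp: preds_def lattice_edges_def)

lemma fin_paths_snoc_iff:
  "u @ [v] \<in> fin_paths \<longleftrightarrow>
     (if u = [] then v = (0, 0) else u \<in> fin_paths \<and> (last u, v) \<in> lattice_edges)"
  by (auto simp: fin_paths_def successively_append_iff)

text \<open>Induction by appending vertices at the end matches \<open>path_weight_snoc\<close> and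
  the recursion of the weights over last edges.\<close>

lemma fin_paths_induct [consumes 1, case_names origin snoc]:
  assumes "u \<in> fin_paths"
    and "P [(0, 0)]"
    and "\<And>u v. u \<in> fin_paths \<Longrightarrow> (last u, v) \<in> lattice_edges \<Longrightarrow> P u \<Longrightarrow> P (u @ [v])"
  shows "P u"
  using assms(1)
proof (induction u rule: rev_induct)
  case Nil
  then show ?case by (simp add: fin_paths_def)
next
  case (snoc v u)
  then show ?case
    using assms(2,3) by (auto simp: fin_paths_snoc_iff split: if_splits)
qed

lemma length_fin_path:
  "u \<in> fin_paths \<Longrightarrow> length u = Suc (fst (last u) + snd (last u))"
  by (induction u rule: fin_paths_induct) (auto simp: lattice_edges_def)

lemma Nil_not_fin_path [simp]: "[] \<notin> fin_paths"
  by (simp add: fin_paths_def)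

lemma fin_path_nonempty: "u \<in> fin_paths \<Longrightarrow> u \<noteq> []"
  by auto

lemma paths_to_iff: "u \<in> paths_to v \<longleftrightarrow> u \<in> fin_paths \<and> last u = v"
  by (simp add: paths_to_def)

lemma prefix_origin: "u \<in> fin_paths \<Longrightarrow> prefix [(0, 0)] u"
  by (cases u) (auto simp: fin_paths_def)

lemma length_paths_to: "p \<in> paths_to v \<Longrightarrow> length p = Suc (fst v + snd v)"
  by (auto simp: paths_to_def length_fin_path)

lemma paths_to_origin: "paths_to (0, 0) = {[(0, 0)]}"
proof -
  have "p = [(0, 0)]" if "p \<in> paths_to (0, 0)" for p
    using length_paths_to[OF that] that
    by (cases p) (auto simp: paths_to_def fin_paths_def)
  then show ?thesis
    by (auto simp: paths_to_def fin_paths_def)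
qed

lemma paths_to_step:
  assumes "v \<noteq> (0, 0)"
  shows "paths_to v = (\<lambda>p. p @ [v]) ` (\<Union>x\<in>preds v. paths_to x)"
proof (intro equalityI subsetI)
  fix p assume p: "p \<in> paths_to v"
  then have "p \<noteq> []" by (auto simp: paths_to_def)
  then obtain p' z where eq: "p = p' @ [z]" by (metis rev_exhaust)
  with p assms show "p \<in> (\<lambda>p. p @ [v]) ` (\<Union>x\<in>preds v. paths_to x)"
    by (auto simp: paths_to_def fin_paths_snoc_iff preds_def split: if_splits)
next
  fix p assume "p \<in> (\<lambda>p. p @ [v]) ` (\<Union>x\<in>preds v. paths_to x)"
  then obtain x q where "p = q @ [v]" "(x, v) \<in> lattice_edges" "q \<in> paths_to x"
    by (auto simp: preds_def)
  then show "p \<in> paths_to v"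
    by (auto simp: paths_to_def fin_paths_snoc_iff)
qed

lemma finite_paths_to [simp]: "finite (paths_to v)"
proof (induction "fst v + snd v" arbitrary: v)
  case 0
  then have "v = (0, 0)" by (cases v) auto
  then show ?case by (simp add: paths_to_origin)
next
  case (Suc n)
  then have v: "v \<noteq> (0, 0)" by auto
  have "finite (paths_to x)" if "x \<in> preds v" for x
    using Suc.hyps(1)[of x] Suc.hyps(2) level_preds[OF that] by linarith
  then show ?case unfolding paths_to_step[OF v] by (intro finite_imageI finite_UN_I finite_preds)
qed

lemma paths_to_nonempty [simp]: "paths_to v \<noteq> {}"
proof (induction "fst v + snd v" arbitrary: v)
  case 0
  then have "v = (0, 0)" by (cases v) auto
  then show ?case by (simp add: paths_to_origin)
next
  case (Suc n)
  then have v: "v \<noteq> (0, 0)" by auto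
  then have "preds v \<noteq> {}"
    by (cases v; cases "fst v"; cases "snd v") auto
  then obtain x where x: "x \<in> preds v" by auto
  then have "n = fst x + snd x" using Suc.hyps(2) level_preds by fastforce
  then have "paths_to x \<noteq> {}" using Suc.hyps(1) by blast
  with x show ?case unfolding paths_to_step[OF v] by blast
qed

lemma path_weight_snoc:
  assumes "p \<noteq> []"
  shows "path_weight w (p @ [v]) = path_weight w p * w (last p, v)"
proof -
  obtain k where k: "length p = Suc k" using assms by (cases p) auto
  have "path_weight w (p @ [v])
      = (\<Prod>i<k. w ((p @ [v]) ! i, (p @ [v]) ! Suc i)) * w (last p, v)"
    using k assms by (simp add: path_weight_def nth_append last_conv_nth)
  also have "(\<Prod>i<k. w ((p @ [v]) ! i, (p @ [v]) ! Suc i)) = (\<Prod>i<k. w (p ! i, p ! Suc i))"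
    using k by (intro prod.cong) (auto simp: nth_append)
  finally show ?thesis using k by (simp add: path_weight_def)
qed

section \<open>Infinite paths and their laws\<close>

lemma starts_with_iff_nth: "starts_with s u \<longleftrightarrow> (\<forall>i<length u. s i = u ! i)"
  unfolding starts_with_def list_eq_iff_nth_eq by auto

lemma starts_with_same_length:
  "starts_with s u \<Longrightarrow> starts_with s u' \<Longrightarrow> length u = length u' \<Longrightarrow> u = u'"
  unfolding starts_with_iff_nth by (metis nth_equalityI)

lemma inf_path_level: "s \<in> inf_paths \<Longrightarrow> fst (s n) + snd (s n) = n"
proof (induction n)
  case 0
  then show ?case by (simp add: inf_paths_def)
next
  case (Suc n)
  then have "(s n, s (Suc n)) \<in> lattice_edges" by (simp add: inf_paths_def)
  with Suc show ?case by (auto simp: lattice_edges_def)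
qed

lemma inf_path_coords:
  assumes "s \<in> inf_paths"
  obtains h where "h \<le> n" "s n = (h, n - h)"
  using inf_path_level[OF assms, of n] by (metis add_diff_cancel_left' le_add1 prod.collapse)

lemma inf_path_initial_segment:
  assumes "s \<in> inf_paths"
  shows "map s [0..<Suc n] \<in> paths_to (s n)"
proof (induction n)
  case 0
  show ?case using assms by (simp add: paths_to_iff inf_paths_def fin_paths_def)
next
  case (Suc n)
  have "map s [0..<Suc (Suc n)] = map s [0..<Suc n] @ [s (Suc n)]" by simp
  moreover have "(s n, s (Suc n)) \<in> lattice_edges" using assms by (simp add: inf_paths_def)
  ultimately show ?case
    using Suc unfolding paths_to_iff by (simp only: fin_paths_snoc_iff) simp
qed

section \<open>Cylinder sets as a generator stable under intersection\<close>

definition cylinder :: "vertex list \<Rightarrow> (nat \<Rightarrow> vertex) set" where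
  "cylinder u = {s \<in> inf_paths. starts_with s u}"

lemma cylinder_origin: "cylinder [(0, 0)] = inf_paths"
  by (auto simp: cylinder_def starts_with_def inf_paths_def)

text \<open>Turns a coordinate event into a finite union of cylinders. The length condition makes
  the right side false for every path when \<open>v\<close> does not lie on level
  \<open>n\<close>.\<close>

lemma coordinate_eq_cylinders:
  assumes "s \<in> inf_paths"
  shows "s n = v \<longleftrightarrow> (\<exists>u\<in>paths_to v. length u = Suc n \<and> starts_with s u)"
proof
  assume "s n = v"
  then show "\<exists>u\<in>paths_to v. length u = Suc n \<and> starts_with s u"
    using inf_path_initial_segment[OF assms, of n]
    by (intro bexI[of _ "map s [0..<Suc n]"]) (auto simp: starts_with_def simp del: upt_Suc)
next
  assume "\<exists>u\<in>paths_to v. length u = Suc n \<and> starts_with s u"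
  then obtain u where u: "u \<in> fin_paths" "last u = v" "length u = Suc n" "starts_with s u"
    by (auto simp: paths_to_iff)
  then show "s n = v" by (auto simp: starts_with_iff_nth last_conv_nth fin_path_nonempty)
qed

lemma space_path_space: "space path_space = inf_paths"
  by (auto simp: path_space_def space_restrict_space space_PiM)

lemma measurable_coordinate: "(\<lambda>s. s n) \<in> path_space \<rightarrow>\<^sub>M count_space UNIV"
  unfolding path_space_def by (intro measurable_restrict_space1 measurable_component_singleton) simp

lemma coordinate_sets: "{s \<in> inf_paths. s n = v} \<in> sets path_space"
proof -
  have "(\<lambda>s. s n) -` {v} \<inter> space path_space \<in> sets path_space"
    by (rule measurable_sets[OF measurable_coordinate]) simp
  then show ?thesis by (simp add: space_path_space vimage_def Int_def conj_commute)
qed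

lemma cylinder_sets: "cylinder u \<in> sets path_space"
proof -
  have "cylinder u = inf_paths \<inter> (\<Inter>i\<in>{..<length u}. {s \<in> inf_paths. s i = u ! i})"
    by (auto simp: cylinder_def starts_with_iff_nth)
  moreover have "inf_paths \<inter> (\<Inter>i\<in>I. {s \<in> inf_paths. s i = u ! i}) \<in> sets path_space"
    if "finite I" for I
    using that
  proof (induction I rule: finite_induct)
    case empty
    show ?case using sets.top[of path_space] by (simp add: space_path_space)
  next
    case (insert i I)
    have "inf_paths \<inter> (\<Inter>i\<in>insert i I. {s \<in> inf_paths. s i = u ! i})
        = {s \<in> inf_paths. s i = u ! i} \<inter> (inf_paths \<inter> (\<Inter>i\<in>I. {s \<in> inf_paths. s i = u ! i}))"
      by auto
    then show ?case using insert coordinate_sets by (simp only:) (rule sets.Int)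
  qed
  ultimately show ?thesis by simp
qed

text \<open>The empty set is included because incompatible initial segments have disjoint cylinders,
  and the family is to be closed under intersection.\<close>

definition cylinders :: "(nat \<Rightarrow> vertex) set set" where
  "cylinders = insert {} (cylinder ` fin_paths)"

lemma cylinders_subset: "cylinders \<subseteq> Pow inf_paths"
  by (auto simp: cylinders_def cylinder_def)

text \<open>For the inclusion from left to right, each coordinate is measurable for the
  sigma-algebra of the cylinders, by \<open>coordinate_eq_cylinders\<close>. Hence the identity is
  measurable from that sigma-algebra into \<open>path_space\<close>, and its preimages give the
  claim.\<close>

lemma sets_path_space: "sets path_space = sigma_sets inf_paths cylinders"
proof
  have "cylinders \<subseteq> sets path_space"
    using cylinder_sets by (auto simp: cylinders_def)
  then show "sigma_sets inf_paths cylinders \<subseteq> sets path_space"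
    using sets.sigma_sets_subset[of cylinders path_space] by (simp add: space_path_space)
next
  let ?S = "sigma inf_paths cylinders"
  have space: "space ?S = inf_paths" using cylinders_subset by simp
  have sets: "sets ?S = sigma_sets inf_paths cylinders" using cylinders_subset by simp
  have coord: "(\<lambda>s. s n) \<in> ?S \<rightarrow>\<^sub>M count_space UNIV" for n
    unfolding measurable_count_space_eq2_countable
  proof (intro conjI ballI)
    fix v :: vertex
    have "(\<lambda>s. s n) -` {v} \<inter> space ?S = (\<Union>u\<in>{u \<in> paths_to v. length u = Suc n}. cylinder u)"
      unfolding space cylinder_def using coordinate_eq_cylinders[of _ n v] by blast
    also have "\<dots> \<in> sets ?S"
    proof (rule sets.finite_UN)
      show "finite {u \<in> paths_to v. length u = Suc n}" by simp
      fix u assume "u \<in> {u \<in> paths_to v. length u = Suc n}"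
      then have "cylinder u \<in> cylinders" by (simp add: cylinders_def paths_to_iff)
      then show "cylinder u \<in> sets ?S" unfolding sets by (rule sigma_sets.Basic)
    qed
    finally show "(\<lambda>s. s n) -` {v} \<inter> space ?S \<in> sets ?S" .
  qed simp
  have "(\<lambda>s n. s n) \<in> ?S \<rightarrow>\<^sub>M (\<Pi>\<^sub>M n\<in>UNIV. count_space UNIV)"
    by (intro measurable_PiM_single' coord) auto
  then have id: "(\<lambda>s. s) \<in> ?S \<rightarrow>\<^sub>M path_space"
    unfolding path_space_def by (intro measurable_restrict_space2) (auto simp: space)
  show "sets path_space \<subseteq> sigma_sets inf_paths cylinders"
  proof
    fix A assume A: "A \<in> sets path_space"
    then have "A \<subseteq> inf_paths" using sets.sets_into_space space_path_space by blast
    then show "A \<in> sigma_sets inf_paths cylinders"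
      using measurable_sets[OF id A] unfolding space sets by (simp add: Int_absorb2)
  qed
qed

text \<open>Two cylinders are nested or disjoint: a common path makes the shorter segment an initial
  part of the longer one.\<close>

lemma cylinder_Int:
  assumes "length u \<le> length u'" "cylinder u \<inter> cylinder u' \<noteq> {}"
  shows "cylinder u \<inter> cylinder u' = cylinder u'"
proof -
  obtain s where "starts_with s u" "starts_with s u'"
    using assms(2) by (auto simp: cylinder_def)
  then have "u ! i = u' ! i" if "i < length u" for i
    using that assms(1) unfolding starts_with_iff_nth by (metis less_le_trans)
  then have "starts_with r u" if "starts_with r u'" for r
    using that assms(1) unfolding starts_with_iff_nth by simp
  then show ?thesis by (auto simp: cylinder_def)
qed

lemma Int_stable_cylinders: "Int_stable cylinders"
proof (rule Int_stableI)
  fix A B assume "A \<in> cylinders" "B \<in> cylinders"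
  then consider "A \<inter> B = {}" | u u' where "A = cylinder u" "u \<in> fin_paths" "B = cylinder u'" "u' \<in> fin_paths"
    by (auto simp: cylinders_def)
  then show "A \<inter> B \<in> cylinders"
  proof cases
    case 2
    then show ?thesis
      using cylinder_Int[of u u'] cylinder_Int[of u' u]
      by (cases "A \<inter> B = {}"; cases "length u \<le> length u'") (auto simp: cylinders_def Int_commute)
  qed (simp add: cylinders_def)
qed

lemma path_law_space: "P \<in> path_laws \<Longrightarrow> space P = inf_paths"
  by (auto simp: path_laws_def space_path_space dest: sets_eq_imp_space_eq)

lemma path_law_starts_with:
  "P \<in> path_laws \<Longrightarrow> \<P>(s in P. starts_with s u) = measure P (cylinder u)"
  by (simp add: path_law_space cylinder_def)

text \<open>Uniqueness of measures on an intersection-stable generator. The one-vertex path has the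
  whole space as its cylinder, which provides the exhausting sequence.\<close>

lemma path_law_eqI:
  assumes P: "P \<in> path_laws" "P' \<in> path_laws"
    and eq: "\<And>u. u \<in> fin_paths \<Longrightarrow> \<P>(s in P. starts_with s u) = \<P>(s in P'. starts_with s u)"
  shows "P = P'"
proof -
  interpret P: prob_space P using P(1) by (simp add: path_laws_def)
  interpret P': prob_space P' using P(2) by (simp add: path_laws_def)
  have "[(0, 0)] \<in> fin_paths" by (simp add: fin_paths_def)
  then have whole: "inf_paths \<in> cylinders"
    using cylinder_origin by (force simp: cylinders_def)
  show ?thesis
  proof (rule measure_eqI_generator_eq[OF Int_stable_cylinders cylinders_subset])
    fix X assume "X \<in> cylinders"
    then show "emeasure P X = emeasure P' X"
      using eq path_law_starts_with[OF P(1)] path_law_starts_with[OF P(2)]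
      by (auto simp: cylinders_def P.emeasure_eq_measure P'.emeasure_eq_measure)
  qed (use P whole in \<open>auto simp: path_laws_def sets_path_space\<close>)
qed

text \<open>The only edge from the origin to a vertex with first coordinate 1 leads to
  \<open>(1, 0)\<close>. Thus the map of the theorem is a cylinder probability, one of the
  coordinates that define the weak topology.\<close>

lemma first_step_prob_eq:
  assumes "P \<in> path_laws"
  shows "first_step_prob P = \<P>(s in P. starts_with s [(0, 0), (Suc 0, 0)])"
proof -
  have "fst (s 1) = 1 \<longleftrightarrow> starts_with s [(0, 0), (Suc 0, 0)]" if "s \<in> inf_paths" for s
  proof -
    have "s 0 = (0, 0)" "(s 0, s (Suc 0)) \<in> lattice_edges"
      using that unfolding inf_paths_def by blast+
    then show ?thesis by (auto simp: edge_from_iff starts_with_def)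
  qed
  then show ?thesis
    unfolding first_step_prob_def path_law_space[OF assms] by (metis (mono_tags, lifting) Collect_cong)
qed

section \<open>A law with prescribed cylinder probabilities\<close>

definition lattice_step :: "vertex \<Rightarrow> bool \<Rightarrow> vertex" where
  "lattice_step v b = (if b then (Suc (fst v), snd v) else (fst v, Suc (snd v)))"

lemma lattice_step_inj: "lattice_step v b = lattice_step v c \<longleftrightarrow> b = c"
  by (auto simp: lattice_step_def)

text \<open>The walk reads its next direction off a Bernoulli variable attached to the whole
  path walked so far, so that it never uses the same variable twice.\<close>

primrec walk :: "(vertex list \<Rightarrow> bool) \<Rightarrow> nat \<Rightarrow> vertex list" where
  "walk B 0 = [(0, 0)]"
| "walk B (Suc n) = walk B n @ [lattice_step (last (walk B n)) (B (walk B n))]"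

lemma walk_segment: "map (\<lambda>n. last (walk B n)) [0..<Suc n] = walk B n"
  by (induction n) auto

lemma walk_inf_path: "(\<lambda>n. last (walk B n)) \<in> inf_paths"
proof -
  have "(v, lattice_step v b) \<in> lattice_edges" for v b
    by (cases v) (auto simp: lattice_step_def lattice_edges_def)
  then show ?thesis by (simp add: inf_paths_def)
qed

lemma starts_with_walk:
  "u \<noteq> [] \<Longrightarrow> starts_with (\<lambda>n. last (walk B n)) u \<longleftrightarrow> walk B (length u - 1) = u"
  unfolding starts_with_def using walk_segment[of B "length u - 1"] by simp

lemma fin_paths_lattice_step: "u \<in> fin_paths \<Longrightarrow> u @ [lattice_step (last u) b] \<in> fin_paths"
  by (cases "last u") (auto simp: fin_paths_snoc_iff lattice_step_def edge_from_iff)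

text \<open>The law is that of the walk driven by independent Bernoulli variables, one for each
  vertex list. The variable at \<open>u\<close> takes the value True with the conditional
  probability, under \<open>F\<close>, of increasing the first coordinate after
  \<open>u\<close>.\<close>

lemma path_law_exists:
  fixes F :: "vertex list \<Rightarrow> real"
  assumes F0: "F [(0, 0)] = 1"
    and nonneg: "\<And>u. u \<in> fin_paths \<Longrightarrow> 0 \<le> F u"
    and split: "\<And>u. u \<in> fin_paths \<Longrightarrow>
      F u = F (u @ [lattice_step (last u) True]) + F (u @ [lattice_step (last u) False])"
  obtains P where "P \<in> path_laws"
    and "\<And>u. u \<in> fin_paths \<Longrightarrow> \<P>(s in P. starts_with s u) = F u"
proof -
  \<comment> \<open>If \<open>F u = 0\<close>, division gives \<open>r u = 0\<close>. This does no
    harm, since nonnegativity and \<open>split\<close> make both one-step extensions of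
    \<open>u\<close> have value 0.\<close>
  define r where "r u = F (u @ [lattice_step (last u) True]) / F u" for u
  define N where "N u = measure_pmf (bernoulli_pmf (r u))" for u
  define M where "M = (\<Pi>\<^sub>M u\<in>UNIV. N u)"
  interpret product_prob_space N UNIV
    unfolding product_prob_space_def product_prob_space_axioms_def product_sigma_finite_def N_def
    by (auto intro: measure_pmf.prob_space_axioms prob_space_imp_sigma_finite)
  have space_M: "space M = UNIV" by (simp add: M_def space_PiM N_def)
  have coord: "(\<lambda>B. B u) \<in> M \<rightarrow>\<^sub>M count_space UNIV" for u
  proof -
    have "(\<lambda>B. B u) \<in> M \<rightarrow>\<^sub>M N u" unfolding M_def by (rule measurable_component_singleton) simp
    then show ?thesis
      using measurable_cong_sets[of M M "N u" "count_space UNIV"] by (simp add: N_def)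
  qed
  have walk_meas: "(\<lambda>B. walk B n) \<in> M \<rightarrow>\<^sub>M count_space UNIV" for n
  proof (induction n)
    case 0
    show ?case by simp
  next
    case (Suc n)
    \<comment> \<open>The variable read next depends on the walk itself. Fixing its index
      \<open>u\<close> suffices, because there are only countably many vertex lists.\<close>
    have "(\<lambda>B. u @ [lattice_step (last u) (B u)]) \<in> M \<rightarrow>\<^sub>M count_space UNIV" for u
      by (rule measurable_compose[OF coord]) simp
    from measurable_compose_countable[OF this Suc] show ?case by simp
  qed
  define path where "path B n = last (walk B n)" for B n
  have path_inf: "path B \<in> inf_paths" for B
    using walk_inf_path unfolding path_def .
  have "(\<lambda>B n. path B n) \<in> M \<rightarrow>\<^sub>M (\<Pi>\<^sub>M n\<in>UNIV. count_space UNIV)"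
    unfolding path_def
    by (intro measurable_PiM_single' measurable_compose[OF walk_meas]) auto
  then have path_meas: "path \<in> M \<rightarrow>\<^sub>M path_space"
    unfolding path_space_def using path_inf by (intro measurable_restrict_space2) auto
  have r: "0 \<le> r u \<and> r u \<le> 1" "F u * r u = F (u @ [lattice_step (last u) True])"
    if u: "u \<in> fin_paths" for u
  proof -
    have "0 \<le> F (u @ [lattice_step (last u) b])" for b
      using nonneg fin_paths_lattice_step[OF u] by simp
    from this[of True] this[of False] split[OF u]
    show "0 \<le> r u \<and> r u \<le> 1" "F u * r u = F (u @ [lattice_step (last u) True])"
      unfolding r_def by (auto simp: divide_le_eq_1)
  qed
  \<comment> \<open>That the walk follows \<open>u\<close> is a condition on the finitely many
    variables read along \<open>u\<close>, which form \<open>J\<close>. The length bound shows that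
    the variable at \<open>u\<close> is still unread when the path is extended, so it contributes an
    independent factor.\<close>
  have event: "\<exists>J X. finite J \<and> (\<forall>q\<in>J. length q < length u) \<and>
      (\<forall>B. walk B (length u - 1) = u \<longleftrightarrow> (\<forall>q\<in>J. B q \<in> X q)) \<and>
      (\<Prod>q\<in>J. measure (N q) (X q)) = F u" if "u \<in> fin_paths" for u
    using that
  proof (induction u rule: fin_paths_induct)
    case origin
    show ?case using F0 by (intro exI[of _ "{}"]) simp
  next
    case (snoc u v)
    from snoc.IH obtain J X where J: "finite J" "\<forall>q\<in>J. length q < length u"
      and walk: "\<forall>B. walk B (length u - 1) = u \<longleftrightarrow> (\<forall>q\<in>J. B q \<in> X q)"
      and prod: "(\<Prod>q\<in>J. measure (N q) (X q)) = F u" by (elim exE conjE) (rule that)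
    obtain b where v: "v = lattice_step (last u) b"
    proof -
      have "v = lattice_step (last u) True \<or> v = lattice_step (last u) False"
        using snoc(2) by (cases "last u") (auto simp: lattice_step_def edge_from_iff)
      then show ?thesis using that by blast
    qed
    have u: "u \<notin> J" using J(2) by blast
    have J': "\<forall>q\<in>insert u J. length q < length (u @ [v])"
      using J(2) by (simp add: less_Suc_eq)
    have len: "length u = Suc (length u - 1)" using snoc(1) fin_path_nonempty by simp
    have "walk B (length u) = u @ [v] \<longleftrightarrow> walk B (length u - 1) = u \<and> B u = b" for B
      by (subst len) (auto simp: v lattice_step_inj)
    moreover have "(\<forall>q\<in>insert u J. B q \<in> (X(u := {b})) q) \<longleftrightarrow> (\<forall>q\<in>J. B q \<in> X q) \<and> B u = b" for B
      using u by (auto split: if_splits)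
    ultimately have walk': "\<forall>B. walk B (length (u @ [v]) - 1) = u @ [v]
        \<longleftrightarrow> (\<forall>q\<in>insert u J. B q \<in> (X(u := {b})) q)"
      using walk by simp
    have prod': "(\<Prod>q\<in>insert u J. measure (N q) ((X(u := {b})) q)) = F (u @ [v])"
    proof -
      have "(\<Prod>q\<in>J. measure (N q) ((X(u := {b})) q)) = F u"
        unfolding prod[symmetric] using u by (intro prod.cong) auto
      moreover have "F u * measure (N u) {b} = F (u @ [v])"
        using r[OF snoc(1)] split[OF snoc(1)]
        by (cases b) (simp_all add: N_def measure_pmf_single v right_diff_distrib)
      ultimately show ?thesis using J(1) u by (simp add: mult.commute)
    qed
    show ?case
      by (rule exI[of _ "insert u J"], rule exI[of _ "X(u := {b})"])
        (intro conjI J' walk' prod', simp add: J(1))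
  qed
  define P where "P = distr M path_space path"
  have "prob_space M" unfolding M_def by (rule P.prob_space_axioms)
  then have P: "P \<in> path_laws"
    unfolding P_def path_laws_def using path_meas by (simp add: prob_space.prob_space_distr)
  have "\<P>(s in P. starts_with s u) = F u" if u: "u \<in> fin_paths" for u
  proof -
    from event[OF u] obtain J X where J: "finite J"
      and walk: "\<forall>B. walk B (length u - 1) = u \<longleftrightarrow> (\<forall>q\<in>J. B q \<in> X q)"
      and prod: "(\<Prod>q\<in>J. measure (N q) (X q)) = F u" by (elim exE conjE) (rule that)
    have "\<P>(s in P. starts_with s u) = measure M (path -` cylinder u \<inter> space M)"
      unfolding path_law_starts_with[OF P] unfolding P_def
      by (rule measure_distr[OF path_meas cylinder_sets])
    also have "path -` cylinder u \<inter> space M = {B \<in> space M. \<forall>q\<in>J. B q \<in> X q}"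
      using path_inf starts_with_walk[of u] fin_path_nonempty[OF u] walk
      by (auto simp: cylinder_def path_def[abs_def])
    also have "emeasure M \<dots> = (\<Prod>q\<in>J. emeasure (N q) (X q))"
      unfolding M_def by (rule emeasure_PiM_Collect) (auto simp: J N_def)
    then have "measure M {B \<in> space M. \<forall>q\<in>J. B q \<in> X q} = (\<Prod>q\<in>J. measure (N q) (X q))"
      by (simp add: M.emeasure_eq_measure prod_ennreal measure_eq_emeasure_eq_ennreal prod_nonneg)
    finally show ?thesis using prod by simp
  qed
  then show ?thesis using that P by blast
qed

section \<open>Lattice paths through thresholds on the levels\<close>

definition threshold :: "(nat \<Rightarrow> nat \<Rightarrow> bool) \<Rightarrow> nat \<Rightarrow> nat" where
  "threshold R n = (LEAST h. n \<le> h \<or> R n h)"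

lemma threshold_le: "threshold R n \<le> n"
  unfolding threshold_def by (rule Least_le) simp

lemma threshold_reached: "n = threshold R n \<or> R n (threshold R n)"
  using LeastI[of "\<lambda>h. n \<le> h \<or> R n h" n] threshold_le[of R n]
  by (auto simp: threshold_def[symmetric])

lemma threshold_minimal: "R n h \<Longrightarrow> threshold R n \<le> h"
  unfolding threshold_def by (rule Least_le) simp

lemma not_below_threshold: "h < threshold R n \<Longrightarrow> \<not> R n h"
  using threshold_minimal not_le by blast

text \<open>By \<open>up\<close> the threshold grows by at most one per level, and by
  \<open>down\<close> it never decreases. So each step raises exactly one coordinate by one. The
  default value \<open>n\<close>, taken when no smaller index satisfies \<open>R n\<close>, is the
  right end of level \<open>n\<close>.\<close>

lemma threshold_inf_path:
  assumes up: "\<And>n h. h < n \<Longrightarrow> R n h \<Longrightarrow> R (Suc n) (Suc h)"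
    and down: "\<And>n h. h < n \<Longrightarrow> R (Suc n) h \<Longrightarrow> R n h"
  shows "(\<lambda>n. (threshold R n, n - threshold R n)) \<in> inf_paths"
proof -
  have "threshold R 0 = 0" using threshold_le[of R 0] by simp
  moreover have "((threshold R n, n - threshold R n), (threshold R (Suc n), Suc n - threshold R (Suc n)))
      \<in> lattice_edges" for n
  proof -
    have "threshold R (Suc n) \<le> Suc (threshold R n)"
    proof (cases "threshold R n = n")
      case True
      then show ?thesis using threshold_le[of R "Suc n"] by simp
    next
      case False
      then have "threshold R n < n" "R n (threshold R n)"
        using threshold_le[of R n] threshold_reached[of n R] by auto
      then show ?thesis by (intro threshold_minimal up)
    qed
    moreover have "threshold R n \<le> threshold R (Suc n)"
    proof (rule ccontr)
      assume less: "\<not> threshold R n \<le> threshold R (Suc n)"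
      then have n: "threshold R (Suc n) < n" using threshold_le[of R n] by linarith
      then have "R (Suc n) (threshold R (Suc n))"
        using threshold_reached[of "Suc n" R] by linarith
      with n have "R n (threshold R (Suc n))" by (rule down)
      then show False using less threshold_minimal by blast
    qed
    ultimately have "threshold R (Suc n) = threshold R n \<or> threshold R (Suc n) = Suc (threshold R n)"
      by linarith
    then show ?thesis
      using threshold_le[of R n] by (auto simp: lattice_edges_def Suc_diff_le)
  qed
  ultimately show ?thesis by (simp add: inf_paths_def)
qed

section \<open>Elementary measures\<close>

text \<open>The numerator of \<open>elementary_start_prob\<close>, which satisfies a linear
  recursion without normalising factors.\<close>

definition extension_weight ::
    "(vertex \<times> vertex \<Rightarrow> real) \<Rightarrow> vertex \<Rightarrow> vertex list \<Rightarrow> real" where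
  "extension_weight w v u = (\<Sum>p\<in>{p \<in> paths_to v. prefix u p}. path_weight w p)"

lemma extension_weight_origin: "extension_weight w v [(0, 0)] = total_weight w v"
proof -
  have "{p \<in> paths_to v. prefix [(0, 0)] p} = paths_to v"
    using prefix_origin by (auto simp: paths_to_def)
  then show ?thesis by (simp add: extension_weight_def total_weight_def)
qed

text \<open>Paths to \<open>v\<close> are sorted by their last edge. The length hypothesis
  guarantees that \<open>u\<close> is still a prefix after the final vertex is removed.\<close>

lemma extension_weight_step:
  assumes u: "length u \<le> fst v + snd v" and v: "v \<noteq> (0, 0)"
  shows "extension_weight w v u = (\<Sum>x\<in>preds v. w (x, v) * extension_weight w x u)"
proof -
  let ?A = "\<lambda>x. {p \<in> paths_to x. prefix u p}"
  have iff: "prefix u (p @ [v]) \<longleftrightarrow> prefix u p" if "x \<in> preds v" "p \<in> paths_to x" for x p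
    using length_paths_to[OF that(2)] level_preds[OF that(1)] u by (auto simp: prefix_snoc)
  have "{p \<in> paths_to v. prefix u p} = (\<lambda>p. p @ [v]) ` (\<Union>x\<in>preds v. ?A x)"
    unfolding paths_to_step[OF v] using iff by blast
  then have "extension_weight w v u = (\<Sum>p\<in>(\<Union>x\<in>preds v. ?A x). path_weight w (p @ [v]))"
    by (simp add: extension_weight_def sum.reindex inj_on_def)
  also have "\<dots> = (\<Sum>x\<in>preds v. \<Sum>p\<in>?A x. path_weight w (p @ [v]))"
    by (rule sum.UNION_disjoint) (auto simp: paths_to_iff[symmetric], auto simp: paths_to_iff)
  also have "\<dots> = (\<Sum>x\<in>preds v. \<Sum>p\<in>?A x. w (x, v) * path_weight w p)"
    by (intro sum.cong refl) (auto simp: paths_to_iff path_weight_snoc fin_path_nonempty)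
  finally show ?thesis by (simp add: extension_weight_def sum_distrib_left)
qed

lemma total_weight_step:
  "v \<noteq> (0, 0) \<Longrightarrow> total_weight w v = (\<Sum>x\<in>preds v. w (x, v) * total_weight w x)"
  using extension_weight_step[of "[(0, 0)]" v w]
  by (cases v) (auto simp: extension_weight_origin)

text \<open>On this level a path to \<open>v\<close> has the same length as \<open>u\<close>, so it
  extends \<open>u\<close> only if it equals \<open>u\<close>. This starts the recursion.\<close>

lemma extension_weight_last:
  assumes "u \<in> fin_paths" "length u = Suc (fst v + snd v)"
  shows "extension_weight w v u = (if last u = v then path_weight w u else 0)"
proof -
  have "prefix u p \<longleftrightarrow> u = p" if "p \<in> paths_to v" for p
    using length_paths_to[OF that] assms(2)
    by (metis append_Nil2 append_eq_append_conv prefixE prefix_order.refl)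
  then have "{p \<in> paths_to v. prefix u p} = {p \<in> paths_to v. u = p}"
    by blast
  also have "\<dots> = (if last u = v then {u} else {})"
    using assms(1) by (auto simp: paths_to_def)
  finally have "{p \<in> paths_to v. prefix u p} = (if last u = v then {u} else {})" .
  then show ?thesis by (simp add: extension_weight_def)
qed

text \<open>Paths with a common endpoint have the same continuations. Formally, both sides obey the
  same recursion over last edges, agree on the level of that endpoint, and vanish below it. The
  conditioning property of the limit laws comes from here.\<close>

lemma extension_weight_proportional:
  assumes "u \<in> fin_paths" "u' \<in> fin_paths" "last u = last u'"
  shows "path_weight w u' * extension_weight w v u = path_weight w u * extension_weight w v u'"
proof (induction "fst v + snd v" arbitrary: v rule: less_induct)
  case less
  have len: "length u' = length u"
    using assms by (simp add: length_fin_path)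
  consider "length u \<le> fst v + snd v" | "length u = Suc (fst v + snd v)"
    | "length u > Suc (fst v + snd v)" by linarith
  then show ?case
  proof cases
    case 1
    then have v: "v \<noteq> (0, 0)" using assms(1) fin_path_nonempty by fastforce
    have "path_weight w u' * extension_weight w x u = path_weight w u * extension_weight w x u'"
      if "x \<in> preds v" for x
      using less[of x] level_preds[OF that] by simp
    then have eq: "path_weight w u' * (w (x, v) * extension_weight w x u)
        = path_weight w u * (w (x, v) * extension_weight w x u')" if "x \<in> preds v" for x
      using that by (metis mult.left_commute)
    have len': "length u' \<le> fst v + snd v" using 1 len by simp
    show ?thesis
      unfolding extension_weight_step[OF 1 v] extension_weight_step[OF len' v] sum_distrib_left
      by (intro sum.cong refl eq)
  next
    case 2
    then show ?thesis using assms len by (simp add: extension_weight_last)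
  next
    case 3
    have "\<not> prefix u p" "\<not> prefix u' p" if "p \<in> paths_to v" for p
      using 3 len length_paths_to[OF that] prefix_length_le by fastforce+
    then have "extension_weight w v u = 0" "extension_weight w v u' = 0"
      unfolding extension_weight_def by (auto intro!: sum.neutral)
    then show ?thesis by simp
  qed
qed

text \<open>Since \<open>v\<close> lies on a higher level than the end of \<open>u\<close>, a path
  to \<open>v\<close> that starts with \<open>u\<close> must leave along one of two edges. In the
  limit this becomes additivity of cylinder probabilities.\<close>

lemma extension_weight_split:
  assumes "u \<in> fin_paths" "last u = (h, t)" "h + t < fst v + snd v"
  shows "extension_weight w v u
     = extension_weight w v (u @ [(Suc h, t)]) + extension_weight w v (u @ [(h, Suc t)])"
proof -
  have "prefix u p \<longleftrightarrow> prefix (u @ [(Suc h, t)]) p \<or> prefix (u @ [(h, Suc t)]) p"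
    if p: "p \<in> paths_to v" for p
  proof
    assume "prefix u p"
    then obtain r where r: "p = u @ r" by (auto simp: prefix_def)
    have "length u < length p"
      using length_paths_to[OF p] length_fin_path[OF assms(1)] assms by simp
    then obtain z r' where z: "r = z # r'" using r by (cases r) auto
    have "(last u, z) \<in> lattice_edges"
      using p assms(1) unfolding r z
      by (auto simp: paths_to_def fin_paths_def successively_append_iff)
    then show "prefix (u @ [(Suc h, t)]) p \<or> prefix (u @ [(h, Suc t)]) p"
      unfolding r z assms(2) edge_from_iff by auto
  qed (auto simp: prefix_def)
  then have "{p \<in> paths_to v. prefix u p}
      = {p \<in> paths_to v. prefix (u @ [(Suc h, t)]) p}
        \<union> {p \<in> paths_to v. prefix (u @ [(h, Suc t)]) p}" by auto
  moreover have "{p \<in> paths_to v. prefix (u @ [(Suc h, t)]) p}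
        \<inter> {p \<in> paths_to v. prefix (u @ [(h, Suc t)]) p} = {}"
    by (auto simp: prefix_def)
  ultimately show ?thesis
    by (simp add: extension_weight_def sum.union_disjoint)
qed

section \<open>Averages along the backward chain\<close>

lemma convex_between:
  fixes a x y :: real
  assumes "0 < a" "a < 1" "x \<le> y"
  shows "x \<le> a * x + (1 - a) * y" "a * x + (1 - a) * y \<le> y"
proof -
  have "0 \<le> (1 - a) * (y - x)" "0 \<le> a * (y - x)" using assms by simp_all
  then show "x \<le> a * x + (1 - a) * y" "a * x + (1 - a) * y \<le> y"
    by (simp_all add: algebra_simps)
qed

lemma convex_strictly_between:
  fixes a x y :: real
  assumes "0 < a" "a < 1" "x < y"
  shows "x < a * x + (1 - a) * y" "a * x + (1 - a) * y < y"
proof -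
  have "0 < (1 - a) * (y - x)" "0 < a * (y - x)" using assms by simp_all
  then show "x < a * x + (1 - a) * y" "a * x + (1 - a) * y < y"
    by (simp_all add: algebra_simps)
qed

locale positive_weights =
  fixes w :: "vertex \<times> vertex \<Rightarrow> real"
  assumes weight_pos: "\<And>e. e \<in> lattice_edges \<Longrightarrow> w e > 0"
begin

lemma path_weight_pos: "u \<in> fin_paths \<Longrightarrow> path_weight w u > 0"
proof (induction u rule: fin_paths_induct)
  case origin
  show ?case by (simp add: path_weight_def)
next
  case (snoc u v)
  then show ?case
    using weight_pos fin_path_nonempty by (simp add: path_weight_snoc)
qed

lemma total_weight_pos: "total_weight w v > 0"
  unfolding total_weight_def
  by (rule sum_pos) (auto simp: paths_to_iff path_weight_pos)

lemma elementary_start_prob_eq: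
  "elementary_start_prob w v u = extension_weight w v u / total_weight w v"
proof -
  have "elementary_start_prob w v u
      = measure (elementary_measure w v) {p \<in> paths_to v. prefix u p}"
    by (simp add: elementary_start_prob_def elementary_measure_def space_point_measure)
  also have "\<dots> = (\<Sum>p\<in>{p \<in> paths_to v. prefix u p}. path_weight w p / total_weight w v)"
  proof -
    have nonneg: "0 \<le> path_weight w p / total_weight w v" if "p \<in> paths_to v" for p
      using that path_weight_pos[of p] total_weight_pos[of v]
      by (simp add: paths_to_iff less_imp_le)
    have "emeasure (elementary_measure w v) {p \<in> paths_to v. prefix u p}
        = (\<Sum>p\<in>{p \<in> paths_to v. prefix u p}. ennreal (path_weight w p / total_weight w v))"
      unfolding elementary_measure_def by (rule emeasure_point_measure_finite) auto
    also have "\<dots> = ennreal (\<Sum>p\<in>{p \<in> paths_to v. prefix u p}. path_weight w p / total_weight w v)"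
      using nonneg by (intro sum_ennreal) blast
    finally show ?thesis
      by (rule measure_eq_emeasure_eq_ennreal[rotated]) (intro sum_nonneg, use nonneg in blast)
  qed
  finally show ?thesis by (simp add: extension_weight_def sum_divide_distrib)
qed

abbreviation start_prob :: "vertex \<Rightarrow> vertex list \<Rightarrow> real" where
  "start_prob \<equiv> elementary_start_prob w"

lemma start_prob_nonneg: "start_prob v u \<ge> 0"
  by (simp add: elementary_start_prob_def)

lemma start_prob_origin: "start_prob v [(0, 0)] = 1"
  using total_weight_pos[of v] by (simp add: elementary_start_prob_eq extension_weight_origin)

text \<open>The probability that the backward chain at \<open>(Suc h, Suc t)\<close> steps to \<open>(h, Suc t)\<close>.\<close>

definition back_prob :: "nat \<Rightarrow> nat \<Rightarrow> real" where
  "back_prob h t = w ((h, Suc t), (Suc h, Suc t)) * total_weight w (h, Suc t)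
     / total_weight w (Suc h, Suc t)"

lemma back_prob_compl:
  "1 - back_prob h t = w ((Suc h, t), (Suc h, Suc t)) * total_weight w (Suc h, t)
     / total_weight w (Suc h, Suc t)"
  using total_weight_pos[of "(Suc h, Suc t)"] total_weight_step[of "(Suc h, Suc t)" w]
  by (simp add: back_prob_def field_simps)

lemma back_prob_bounds: "0 < back_prob h t" "back_prob h t < 1"
proof -
  show "0 < back_prob h t"
    unfolding back_prob_def
    by (intro divide_pos_pos mult_pos_pos total_weight_pos weight_pos) (auto simp: lattice_edges_def)
  have "0 < 1 - back_prob h t"
    unfolding back_prob_compl
    by (intro divide_pos_pos mult_pos_pos total_weight_pos weight_pos) (auto simp: lattice_edges_def)
  then show "back_prob h t < 1" by simp
qed

text \<open>Harmonicity for the backward chain: the value at a vertex is the mean of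
  \<open>f\<close> over its random predecessor, as soon as the predecessors lie on level
  \<open>m\<close> or higher. A nonzero vertex on an axis has one predecessor and copies its
  value.\<close>

definition harmonic_above :: "nat \<Rightarrow> (vertex \<Rightarrow> real) \<Rightarrow> bool" where
  "harmonic_above m f \<longleftrightarrow>
     (\<forall>h\<ge>m. f (Suc h, 0) = f (h, 0)) \<and> (\<forall>t\<ge>m. f (0, Suc t) = f (0, t)) \<and>
     (\<forall>h t. m \<le> Suc (h + t) \<longrightarrow>
        f (Suc h, Suc t) = back_prob h t * f (h, Suc t) + (1 - back_prob h t) * f (Suc h, t))"

text \<open>Dividing the recursion of \<open>extension_weight\<close> by \<open>total_weight\<close>
  turns its coefficients into backward transition probabilities, which do not depend on
  \<open>u\<close>.\<close>

lemma start_prob_harmonic: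
  assumes "length u \<le> Suc m"
  shows "harmonic_above m (\<lambda>v. start_prob v u)"
  unfolding harmonic_above_def
proof (intro conjI allI impI)
  fix h assume "m \<le> h"
  then have "length u \<le> Suc h" using assms by simp
  moreover have "w ((h, 0), (Suc h, 0)) > 0" by (auto simp: lattice_edges_def intro!: weight_pos)
  ultimately show "start_prob (Suc h, 0) u = start_prob (h, 0) u"
    by (simp add: elementary_start_prob_eq extension_weight_step total_weight_step)
next
  fix t assume "m \<le> t"
  then have "length u \<le> Suc t" using assms by simp
  moreover have "w ((0, t), (0, Suc t)) > 0" by (auto simp: lattice_edges_def intro!: weight_pos)
  ultimately show "start_prob (0, Suc t) u = start_prob (0, t) u"
    by (simp add: elementary_start_prob_eq extension_weight_step total_weight_step)
next
  fix h t assume "m \<le> Suc (h + t)"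
  then have "length u \<le> Suc (Suc (h + t))" using assms by simp
  then have "extension_weight w (Suc h, Suc t) u
      = w ((h, Suc t), (Suc h, Suc t)) * extension_weight w (h, Suc t) u
        + w ((Suc h, t), (Suc h, Suc t)) * extension_weight w (Suc h, t) u"
    by (simp add: extension_weight_step)
  then show "start_prob (Suc h, Suc t) u
      = back_prob h t * start_prob (h, Suc t) u + (1 - back_prob h t) * start_prob (Suc h, t) u"
    using total_weight_pos[of "(h, Suc t)"] total_weight_pos[of "(Suc h, t)"]
    by (simp add: elementary_start_prob_eq back_prob_compl add_divide_distrib) (simp add: back_prob_def)
qed

text \<open>Lets a start probability be compared with a multiple of \<open>head_prob\<close>, since
  the averaging weights are common to all functions.\<close>

lemma harmonic_above_combination:
  assumes "harmonic_above m f" "harmonic_above m g"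
  shows "harmonic_above m (\<lambda>v. a * f v + b * g v)"
proof -
  have "a * (c * x + (1 - c) * y) + b * (c * x' + (1 - c) * y')
      = c * (a * x + b * x') + (1 - c) * (a * y + b * y')" for c x y x' y' :: real
    by (simp add: algebra_simps)
  then show ?thesis using assms by (simp add: harmonic_above_def)
qed

definition increasing_at :: "nat \<Rightarrow> (vertex \<Rightarrow> real) \<Rightarrow> bool" where
  "increasing_at n f \<longleftrightarrow> (\<forall>h t. Suc (h + t) = n \<longrightarrow> f (h, Suc t) \<le> f (Suc h, t))"

text \<open>The value at \<open>(h, Suc t)\<close> averages those at \<open>(h, t)\<close> and its
  left neighbour, and the value at \<open>(Suc h, t)\<close> averages those at \<open>(h, t)\<close>
  and its right neighbour. On an axis the missing neighbour leaves an equality.\<close>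

lemma interlacing:
  assumes "harmonic_above m f" "increasing_at (h + t) f" "m \<le> h + t"
  shows "f (h, Suc t) \<le> f (h, t)" "f (h, t) \<le> f (Suc h, t)"
proof -
  show "f (h, Suc t) \<le> f (h, t)"
    using assms
    by (cases h) (auto simp: harmonic_above_def increasing_at_def
        intro!: convex_between back_prob_bounds)
  show "f (h, t) \<le> f (Suc h, t)"
    using assms
    by (cases t) (auto simp: harmonic_above_def increasing_at_def
        intro!: convex_between back_prob_bounds)
qed

text \<open>Any two adjacent vertices of the next level are separated by the value at their common
  predecessor.\<close>

lemma increasing_at_above:
  assumes "harmonic_above m f" "increasing_at m f" "m \<le> n"
  shows "increasing_at n f"
  using \<open>m \<le> n\<close>
proof (induction n rule: dec_induct)
  case base
  then show ?case using assms(2) .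
next
  case (step n)
  show ?case
    unfolding increasing_at_def
  proof (intro allI impI)
    fix h t assume "Suc (h + t) = Suc n"
    then show "f (h, Suc t) \<le> f (Suc h, t)"
      using interlacing[OF assms(1), of h t] step by force
  qed
qed

lemma increasing_at_mono:
  assumes "increasing_at n f" "h \<le> h'" "h' \<le> n"
  shows "f (h, n - h) \<le> f (h', n - h')"
  using assms(2,3)
proof (induction h' rule: dec_induct)
  case base
  show ?case by simp
next
  case (step k)
  have "f (k, Suc (n - Suc k)) \<le> f (Suc k, n - Suc k)"
    using assms(1) step by (simp add: increasing_at_def)
  moreover have "Suc (n - Suc k) = n - k" using step by simp
  ultimately show ?case using step by simp
qed

section \<open>Strict monotonicity of the first-step probability along levels\<close>

abbreviation head_prob :: "vertex \<Rightarrow> real" where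
  "head_prob v \<equiv> start_prob v [(0, 0), (Suc 0, 0)]"

lemma head_path: "[(0, 0), (Suc 0, 0)] \<in> fin_paths" "[(0, 0), (0, Suc 0)] \<in> fin_paths"
  by (auto simp: fin_paths_def lattice_edges_def)

lemma head_prob_harmonic: "harmonic_above (Suc m) head_prob"
  by (rule start_prob_harmonic) simp

lemma head_prob_strict: "Suc (h + t) = n \<Longrightarrow> head_prob (h, Suc t) < head_prob (Suc h, t)"
proof (induction n arbitrary: h t)
  case 0
  then show ?case by simp
next
  case (Suc n)
  show ?case
  proof (cases n)
    case 0
    with Suc have "h = 0" "t = 0" by auto
    moreover have "path_weight w [(0, 0), (Suc 0, 0)] > 0"
      by (rule path_weight_pos head_path)+
    ultimately show ?thesis
      using total_weight_pos[of "(Suc 0, 0)"]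
      by (simp add: elementary_start_prob_eq extension_weight_last head_path[simplified])
  next
    case (Suc k)
    have ht: "h + t = n" using Suc.prems by simp
    have har: "harmonic_above n head_prob"
      using head_prob_harmonic Suc by blast
    have "increasing_at n head_prob"
      unfolding increasing_at_def using Suc.IH by (simp add: less_imp_le)
    then have le: "head_prob (h, Suc t) \<le> head_prob (h, t)" "head_prob (h, t) \<le> head_prob (Suc h, t)"
      using interlacing[OF har] ht by auto
    \<comment> \<open>One of the two inequalities in \<open>le\<close> is strict: the left one if
      \<open>h\<close> is positive, the right one if \<open>t\<close> is. Since \<open>n\<close> is
      positive, one of these cases occurs.\<close>
    show ?thesis
    proof (cases h)
      case (Suc h')
      then have "head_prob (h', Suc t) < head_prob (Suc h', t)"
        using Suc.IH ht by simp
      then have "head_prob (h, Suc t) < head_prob (h, t)"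
        using har ht Suc convex_strictly_between[OF back_prob_bounds, of _ _ h' t]
        by (simp add: harmonic_above_def)
      then show ?thesis using le by simp
    next
      case 0
      with ht \<open>n = Suc k\<close> obtain t' where t': "t = Suc t'" by (cases t) auto
      then have "head_prob (h, Suc t') < head_prob (Suc h, t')"
        using Suc.IH ht by simp
      then have "head_prob (h, t) < head_prob (Suc h, t)"
        using har ht t' convex_strictly_between[OF back_prob_bounds, of _ _ h t']
        by (simp add: harmonic_above_def)
      then show ?thesis using le by simp
    qed
  qed
qed

text \<open>On one fixed level there are finitely many increments, and those of
  \<open>head_prob\<close> are positive, so some \<open>L\<close> dominates all ratios. Then
  \<open>L * head_prob\<close> plus or minus the start probability increases on that level, hence on
  all higher ones, with the same \<open>L\<close>.\<close>

lemma start_prob_lipschitz: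
  obtains L where "0 \<le> L"
    and "\<And>n h h'. length u \<le> n \<Longrightarrow> 0 < n \<Longrightarrow> h \<le> n \<Longrightarrow> h' \<le> n \<Longrightarrow>
      \<bar>start_prob (h, n - h) u - start_prob (h', n - h') u\<bar>
        \<le> L * \<bar>head_prob (h, n - h) - head_prob (h', n - h')\<bar>"
proof -
  \<comment> \<open>The maximum with 1 makes \<open>head_prob\<close>, which comes from a path with
    two vertices, harmonic from level \<open>m\<close> on.\<close>
  define m where "m = max 1 (length u)"
  define d where "d f h = f (Suc h, m - Suc h) - f (h, Suc (m - Suc h))" for f :: "vertex \<Rightarrow> real" and h
  define E where "E v = start_prob v u" for v
  \<comment> \<open>The sum of the nonnegative ratios serves as an upper bound for each of
    them.\<close>
  define L where "L = (\<Sum>h<m. \<bar>d E h\<bar> / d head_prob h)"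
  have d_pos: "d head_prob h > 0" if "h < m" for h
    using head_prob_strict[of h "m - Suc h" m] that by (simp add: d_def)
  then have L0: "0 \<le> L"
    unfolding L_def by (intro sum_nonneg divide_nonneg_nonneg) (auto simp: less_imp_le)
  have bound: "\<bar>d E h\<bar> \<le> L * d head_prob h" if "h < m" for h
  proof -
    have "\<bar>d E h\<bar> / d head_prob h \<le> L"
      unfolding L_def using that
      by (intro member_le_sum divide_nonneg_nonneg) (auto simp: less_imp_le d_pos)
    then show ?thesis using d_pos[OF that] by (simp add: divide_le_eq)
  qed
  have har: "harmonic_above m E" "harmonic_above m head_prob"
    unfolding E_def by (rule start_prob_harmonic, simp add: m_def)+
  have inc: "increasing_at n (\<lambda>v. L * head_prob v + c * E v)"
    if c: "c = 1 \<or> c = -1" and n: "m \<le> n" for c n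
  proof (rule increasing_at_above[OF harmonic_above_combination[OF har(2,1)] _ n])
    show "increasing_at m (\<lambda>v. L * head_prob v + c * E v)"
      unfolding increasing_at_def
    proof (intro allI impI)
      fix h t assume ht: "Suc (h + t) = m"
      then have t: "m - Suc h = t" by simp
      show "L * head_prob (h, Suc t) + c * E (h, Suc t) \<le> L * head_prob (Suc h, t) + c * E (Suc h, t)"
        using bound[of h] ht c by (auto simp: d_def t algebra_simps abs_le_iff)
    qed
  qed
  have le: "\<bar>E (h, n - h) - E (h', n - h')\<bar> \<le> L * \<bar>head_prob (h, n - h) - head_prob (h', n - h')\<bar>"
    if "m \<le> n" "h \<le> h'" "h' \<le> n" for n h h'
  proof -
    have "\<bar>E (h, n - h) - E (h', n - h')\<bar> \<le> L * (head_prob (h', n - h') - head_prob (h, n - h))"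
      using increasing_at_mono[OF inc[of 1] that(2,3)] increasing_at_mono[OF inc[of "-1"] that(2,3)] that(1)
      unfolding right_diff_distrib abs_le_iff by auto
    also have "\<dots> \<le> L * \<bar>head_prob (h, n - h) - head_prob (h', n - h')\<bar>"
      using L0 by (intro mult_left_mono) auto
    finally show ?thesis .
  qed
  show ?thesis
  proof (rule that[OF L0])
    fix n h h' assume "length u \<le> n" "0 < n" and h: "h \<le> n" "h' \<le> n"
    then have "m \<le> n" by (simp add: m_def)
    then show "\<bar>start_prob (h, n - h) u - start_prob (h', n - h') u\<bar>
        \<le> L * \<bar>head_prob (h, n - h) - head_prob (h', n - h')\<bar>"
      using le[of n h h'] le[of n h' h] h unfolding E_def
      by (cases "h \<le> h'") (simp_all add: abs_minus_commute)
  qed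
qed

text \<open>After \<open>n\<close> steps both paths are on level \<open>n\<close>, so the comparison
  along a level applies.\<close>

lemma start_prob_lipschitz_paths:
  obtains L where "0 \<le> L"
    and "\<And>s s'. s \<in> inf_paths \<Longrightarrow> s' \<in> inf_paths \<Longrightarrow>
      \<forall>\<^sub>F n in sequentially. \<bar>start_prob (s n) u - start_prob (s' n) u\<bar>
        \<le> L * \<bar>head_prob (s n) - head_prob (s' n)\<bar>"
proof -
  obtain L where L: "0 \<le> L"
    and le: "\<And>n h h'. length u \<le> n \<Longrightarrow> 0 < n \<Longrightarrow> h \<le> n \<Longrightarrow> h' \<le> n \<Longrightarrow>
      \<bar>start_prob (h, n - h) u - start_prob (h', n - h') u\<bar>
        \<le> L * \<bar>head_prob (h, n - h) - head_prob (h', n - h')\<bar>"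
    by (rule start_prob_lipschitz[of u]) blast
  show ?thesis
  proof (rule that[OF L])
    fix s s' assume s: "s \<in> inf_paths" "s' \<in> inf_paths"
    show "\<forall>\<^sub>F n in sequentially. \<bar>start_prob (s n) u - start_prob (s' n) u\<bar>
        \<le> L * \<bar>head_prob (s n) - head_prob (s' n)\<bar>"
      using eventually_ge_at_top[of "Suc (length u)"]
    proof eventually_elim
      case (elim n)
      obtain h where h: "h \<le> n" "s n = (h, n - h)" using inf_path_coords[OF s(1)] .
      obtain h' where h': "h' \<le> n" "s' n = (h', n - h')" using inf_path_coords[OF s(2)] .
      show ?case using le[of n h h'] h h' elim by simp
    qed
  qed
qed

section \<open>The limits of the first-step probability\<close>

definition head_limits :: "real set" where
  "head_limits = {x. \<exists>s. regular_path w s \<and> (\<lambda>n. head_prob (s n)) \<longlonglongrightarrow> x}"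

text \<open>A regular path \<open>s'\<close> whose limit is close to \<open>x\<close> has start
  probabilities that are eventually close to those along \<open>s\<close>, by the Lipschitz bound.
  As the former form a Cauchy sequence, so do the latter.\<close>

lemma regular_path_of_head_limit:
  assumes s: "s \<in> inf_paths" and lim: "(\<lambda>n. head_prob (s n)) \<longlonglongrightarrow> x"
    and x: "x \<in> closure head_limits"
  shows "regular_path w s"
  unfolding regular_path_def
proof (intro conjI ballI s)
  fix u :: "vertex list" assume u: "u \<in> fin_paths"
  obtain L where L: "0 \<le> L"
    and le: "\<And>s s'. s \<in> inf_paths \<Longrightarrow> s' \<in> inf_paths \<Longrightarrow>
      \<forall>\<^sub>F n in sequentially. \<bar>start_prob (s n) u - start_prob (s' n) u\<bar>
        \<le> L * \<bar>head_prob (s n) - head_prob (s' n)\<bar>"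
    by (rule start_prob_lipschitz_paths[of u]) blast
  have "Cauchy (\<lambda>n. start_prob (s n) u)"
  proof (rule metric_CauchyI)
    fix e :: real assume e: "0 < e"
    \<comment> \<open>Using \<open>L + 1\<close> avoids division by zero and makes
      \<open>L * d\<close> strictly smaller than \<open>e / 3\<close>.\<close>
    define d where "d = e / (3 * (L + 1))"
    have d: "0 < d" using e L by (simp add: d_def)
    obtain y where y: "y \<in> head_limits" "dist y x < d"
      using x d by (auto simp: closure_approachable)
    then obtain s' where s': "regular_path w s'" and lim': "(\<lambda>n. head_prob (s' n)) \<longlonglongrightarrow> y"
      by (auto simp: head_limits_def)
    have inf: "s' \<in> inf_paths" using s' by (simp add: regular_path_def)
    have "(\<lambda>n. \<bar>head_prob (s n) - head_prob (s' n)\<bar>) \<longlonglongrightarrow> \<bar>x - y\<bar>"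
      by (intro tendsto_intros lim lim')
    moreover have "\<bar>x - y\<bar> < d" using y(2) by (simp add: dist_real_def abs_minus_commute)
    ultimately have "\<forall>\<^sub>F n in sequentially. \<bar>head_prob (s n) - head_prob (s' n)\<bar> < d"
      by (rule order_tendstoD(2))
    with le[OF s inf]
    have "\<forall>\<^sub>F n in sequentially. \<bar>start_prob (s n) u - start_prob (s' n) u\<bar> < e / 3"
    proof eventually_elim
      case (elim n)
      have "L * \<bar>head_prob (s n) - head_prob (s' n)\<bar> \<le> L * d"
        using elim(2) L by (intro mult_left_mono) auto
      also have "\<dots> < (L + 1) * d" using d by (simp add: algebra_simps)
      also have "\<dots> = e / 3" using L by (simp add: d_def field_simps)
      finally show ?case using elim(1) by simp
    qed
    then obtain N1 where N1: "\<And>n. n \<ge> N1 \<Longrightarrow> \<bar>start_prob (s n) u - start_prob (s' n) u\<bar> < e / 3"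
      by (auto simp: eventually_sequentially)
    have "Cauchy (\<lambda>n. start_prob (s' n) u)"
      using s' u by (intro convergent_Cauchy) (simp add: regular_path_def)
    then obtain N2 where N2: "\<And>m n. m \<ge> N2 \<Longrightarrow> n \<ge> N2 \<Longrightarrow>
        dist (start_prob (s' m) u) (start_prob (s' n) u) < e / 3"
      using e metric_CauchyD[of "\<lambda>n. start_prob (s' n) u" "e / 3"] by auto
    show "\<exists>M. \<forall>m\<ge>M. \<forall>n\<ge>M. dist (start_prob (s m) u) (start_prob (s n) u) < e"
    proof (intro exI allI impI)
      fix m n assume "max N1 N2 \<le> m" "max N1 N2 \<le> n"
      then have "N1 \<le> m" "N1 \<le> n" "N2 \<le> m" "N2 \<le> n" by simp_all
      from N1[OF this(1)] N1[OF this(2)] N2[OF this(3,4)]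
      show "dist (start_prob (s m) u) (start_prob (s n) u) < e"
        unfolding dist_real_def by linarith
    qed
  qed
  then show "convergent (\<lambda>n. start_prob (s n) u)"
    by (rule Cauchy_convergent)
qed

lemma head_prob_bounds: "0 \<le> head_prob v" "head_prob v \<le> 1"
proof -
  show "0 \<le> head_prob v" by (rule start_prob_nonneg)
  have "extension_weight w v [(0, 0), (Suc 0, 0)] \<le> total_weight w v"
    unfolding extension_weight_def total_weight_def
    by (intro sum_mono2) (auto, auto simp: paths_to_iff path_weight_pos less_imp_le)
  then show "head_prob v \<le> 1"
    using total_weight_pos[of v] by (simp add: elementary_start_prob_eq)
qed

text \<open>The extreme values on each level above 0. They settle the cases where a threshold path
  runs along the boundary.\<close>

lemma head_prob_axis: "head_prob (0, Suc t) = 0" "head_prob (Suc h, 0) = 1"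
proof -
  have ax: "head_prob (0, Suc 0) = 0" "head_prob (Suc 0, 0) = 1"
  proof -
    have "extension_weight w (Suc 0, 0) [(0, 0), (Suc 0, 0)] = extension_weight w (Suc 0, 0) [(0, 0)]"
      using extension_weight_split[of "[(0, 0)]" 0 0 "(Suc 0, 0)" w] head_path
      by (simp add: extension_weight_last fin_paths_def)
    then show "head_prob (Suc 0, 0) = 1"
      using total_weight_pos[of "(Suc 0, 0)"]
      by (simp add: elementary_start_prob_eq extension_weight_origin)
    show "head_prob (0, Suc 0) = 0"
      using head_path by (simp add: elementary_start_prob_eq extension_weight_last)
  qed
  show "head_prob (0, Suc t) = 0"
    using ax(1) head_prob_harmonic[of 0] by (induction t) (auto simp: harmonic_above_def)
  show "head_prob (Suc h, 0) = 1"
    using ax(2) head_prob_harmonic[of 0] by (induction h) (auto simp: harmonic_above_def)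
qed

lemma head_prob_increasing: "increasing_at n head_prob"
  unfolding increasing_at_def using head_prob_strict by (auto intro: less_imp_le)

lemma head_prob_interlacing:
  assumes "0 < h + t"
  shows "head_prob (h, Suc t) \<le> head_prob (h, t)" "head_prob (h, t) \<le> head_prob (Suc h, t)"
  using interlacing[OF head_prob_harmonic[of 0] head_prob_increasing, of h t] assms by auto

lemma head_limits_bounds: "head_limits \<subseteq> {0..1}"
proof -
  have "0 \<le> x \<and> x \<le> 1" if "(\<lambda>n. head_prob (s n)) \<longlonglongrightarrow> x" for x s
    using LIMSEQ_le_const[OF that] LIMSEQ_le_const2[OF that] head_prob_bounds by blast
  then show ?thesis by (auto simp: head_limits_def)
qed

text \<open>The path through the rightmost vertices with \<open>head_prob\<close> at most
  \<open>x\<close> is squeezed: regular paths with limits just below \<open>x\<close> eventually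
  stay weakly to its left, which bounds its values from below.\<close>

lemma head_limits_limit_from_below:
  assumes x: "x \<in> closure head_limits"
    and below: "\<And>e. 0 < e \<Longrightarrow> \<exists>y\<in>head_limits. x - e < y \<and> y < x"
  shows "x \<in> head_limits"
proof -
  \<comment> \<open>The index is shifted by one: \<open>R n h\<close> says that the right neighbour
    already exceeds \<open>x\<close>, so for positive \<open>n\<close> the threshold is the last
    vertex with value at most \<open>x\<close>.\<close>
  define R where "R n h \<longleftrightarrow> h < n \<and> x < head_prob (Suc h, n - Suc h)" for n h
  define s where "s n = (threshold R n, n - threshold R n)" for n
  have x0: "0 \<le> x"
    using x head_limits_bounds closure_minimal[of head_limits "{0..1}"] by auto
  have s: "s \<in> inf_paths"
    unfolding s_def
  proof (rule threshold_inf_path)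
    fix n h assume h: "h < n" and "R n h"
    then show "R (Suc n) (Suc h)"
      using head_prob_interlacing(2)[of "Suc h" "n - Suc h"] by (auto simp: R_def)
  next
    fix n h assume h: "h < n" and "R (Suc n) h"
    then show "R n h"
      using head_prob_interlacing(1)[of "Suc h" "n - Suc h"] by (auto simp: R_def Suc_diff_Suc)
  qed
  have le: "head_prob (s n) \<le> x" if "0 < n" for n
  proof (cases "threshold R n")
    case 0
    then show ?thesis using head_prob_axis(1)[of "n - 1"] x0 that by (simp add: s_def)
  next
    case (Suc h)
    then show ?thesis
      using not_below_threshold[of h R n] threshold_le[of R n] by (auto simp: R_def s_def)
  qed
  have ge: "head_prob v \<le> head_prob (s n)" if v: "head_prob v < x" "fst v + snd v = n" for v n
  proof -
    have v_eq: "v = (fst v, n - fst v)" using v(2) by (cases v) auto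
    have "fst v \<le> threshold R n"
    proof (rule ccontr)
      assume *: "\<not> fst v \<le> threshold R n"
      then have "R n (threshold R n)" using threshold_reached[of n R] v(2) by auto
      then have "x < head_prob (Suc (threshold R n), n - Suc (threshold R n))" by (simp add: R_def)
      also have "\<dots> \<le> head_prob v"
        using increasing_at_mono[OF head_prob_increasing, of "Suc (threshold R n)" "fst v" n] * v v_eq by simp
      finally show False using v(1) by simp
    qed
    then show ?thesis
      using increasing_at_mono[OF head_prob_increasing, of "fst v" _ n] threshold_le[of R n] v_eq
      unfolding s_def by metis
  qed
  have lim: "(\<lambda>n. head_prob (s n)) \<longlonglongrightarrow> x"
  proof (rule order_tendstoI)
    fix a assume "a < x"
    then obtain y where y: "y \<in> head_limits" "a < y" "y < x"
      using below[of "x - a"] by auto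
    then obtain s' where s': "s' \<in> inf_paths" "(\<lambda>n. head_prob (s' n)) \<longlonglongrightarrow> y"
      by (auto simp: head_limits_def regular_path_def)
    \<comment> \<open>The strict inequality \<open>y < x\<close> matters: it brings the values along
      \<open>s'\<close> eventually below \<open>x\<close>, as \<open>ge\<close> requires.\<close>
    from order_tendstoD(1)[OF s'(2) y(2)] order_tendstoD(2)[OF s'(2) y(3)]
    show "\<forall>\<^sub>F n in sequentially. a < head_prob (s n)"
      by eventually_elim (rule less_le_trans[OF _ ge[OF _ inf_path_level[OF s'(1)]]])
  next
    fix a assume "x < a"
    then show "\<forall>\<^sub>F n in sequentially. head_prob (s n) < a"
      by (intro eventually_mono[OF eventually_gt_at_top[of 0]]) (use le in \<open>auto intro: le_less_trans\<close>)
  qed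
  show ?thesis
    using regular_path_of_head_limit[OF s lim x] lim by (auto simp: head_limits_def)
qed

text \<open>Mirror image of the previous case, with the leftmost vertices where
  \<open>head_prob\<close> is at least \<open>x\<close>. If only the right end of a positive level
  qualifies, its value is 1, which is at least \<open>x\<close>.\<close>

lemma head_limits_limit_from_above:
  assumes x: "x \<in> closure head_limits"
    and above: "\<And>e. 0 < e \<Longrightarrow> \<exists>y\<in>head_limits. x < y \<and> y < x + e"
  shows "x \<in> head_limits"
proof -
  define R where "R n h \<longleftrightarrow> h \<le> n \<and> x \<le> head_prob (h, n - h)" for n h
  define s where "s n = (threshold R n, n - threshold R n)" for n
  have x1: "x \<le> 1"
    using x head_limits_bounds closure_minimal[of head_limits "{0..1}"] by auto
  have s: "s \<in> inf_paths"
    unfolding s_def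
  proof (rule threshold_inf_path)
    fix n h assume h: "h < n" and "R n h"
    then show "R (Suc n) (Suc h)"
      using head_prob_interlacing(2)[of h "n - h"] by (auto simp: R_def)
  next
    fix n h assume h: "h < n" and "R (Suc n) h"
    then show "R n h"
      using head_prob_interlacing(1)[of h "n - h"] by (auto simp: R_def Suc_diff_le)
  qed
  have ge: "x \<le> head_prob (s n)" if "0 < n" for n
    using threshold_reached[of n R] head_prob_axis(2)[of "n - 1"] x1 that by (auto simp: R_def s_def)
  have le: "head_prob (s n) \<le> head_prob v" if v: "x < head_prob v" "fst v + snd v = n" for v n
  proof -
    have v_eq: "v = (fst v, n - fst v)" using v(2) by (cases v) auto
    then have "R n (fst v)" using v by (auto simp: R_def)
    then have "threshold R n \<le> fst v" by (rule threshold_minimal)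
    then show ?thesis
      using increasing_at_mono[OF head_prob_increasing, of _ "fst v" n] v v_eq
      unfolding s_def by (metis le_add1)
  qed
  have lim: "(\<lambda>n. head_prob (s n)) \<longlonglongrightarrow> x"
  proof (rule order_tendstoI)
    fix a assume "x < a"
    then obtain y where y: "y \<in> head_limits" "x < y" "y < a"
      using above[of "a - x"] by auto
    then obtain s' where s': "s' \<in> inf_paths" "(\<lambda>n. head_prob (s' n)) \<longlonglongrightarrow> y"
      by (auto simp: head_limits_def regular_path_def)
    from order_tendstoD(1)[OF s'(2) y(2)] order_tendstoD(2)[OF s'(2) y(3)]
    show "\<forall>\<^sub>F n in sequentially. head_prob (s n) < a"
      by eventually_elim (rule le_less_trans[OF le[OF _ inf_path_level[OF s'(1)]]])
  next
    fix a assume "a < x"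
    then show "\<forall>\<^sub>F n in sequentially. a < head_prob (s n)"
      by (intro eventually_mono[OF eventually_gt_at_top[of 0]]) (use ge in \<open>auto intro: less_le_trans\<close>)
  qed
  show ?thesis
    using regular_path_of_head_limit[OF s lim x] lim by (auto simp: head_limits_def)
qed

text \<open>A point of the closure outside the set that is not approached from below must be
  approached from above.\<close>

lemma closed_head_limits: "closed head_limits"
proof -
  have "x \<in> head_limits" if x: "x \<in> closure head_limits" for x
  proof (rule ccontr)
    assume x_notin: "x \<notin> head_limits"
    then obtain e where e: "0 < e" "\<And>y. y \<in> head_limits \<Longrightarrow> \<not> (x - e < y \<and> y < x)"
      using head_limits_limit_from_below[OF x] by blast
    have "\<exists>y\<in>head_limits. x < y \<and> y < x + d" if "0 < d" for d
    proof -
      obtain y where y: "y \<in> head_limits" "dist y x < min d e"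
        using x \<open>0 < d\<close> e(1) by (metis closure_approachable min_less_iff_conj)
      moreover have "y \<noteq> x" using y x_notin by auto
      ultimately show ?thesis
        using e(2)[of y] by (intro bexI[of _ y]) (auto simp: dist_real_def)
    qed
    then show False using head_limits_limit_from_above[OF x] x_notin by blast
  qed
  then show ?thesis using closure_subset_eq by blast
qed

section \<open>Measures induced by regular paths\<close>

definition induced_start_prob :: "(nat \<Rightarrow> vertex) \<Rightarrow> vertex list \<Rightarrow> real" where
  "induced_start_prob s u = lim (\<lambda>n. start_prob (s n) u)"

lemma induced_start_prob_lim:
  "regular_path w s \<Longrightarrow> u \<in> fin_paths \<Longrightarrow> (\<lambda>n. start_prob (s n) u) \<longlonglongrightarrow> induced_start_prob s u"
  by (simp add: regular_path_def induced_start_prob_def convergent_LIMSEQ_iff)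

text \<open>The identity holds exactly as soon as \<open>s n\<close> lies beyond the end of
  \<open>u\<close>, and passes to the limit. It is the additivity needed to construct the induced
  law.\<close>

lemma induced_start_prob_split:
  assumes s: "regular_path w s" and u: "u \<in> fin_paths"
  shows "induced_start_prob s u = induced_start_prob s (u @ [lattice_step (last u) True])
    + induced_start_prob s (u @ [lattice_step (last u) False])"
proof (rule LIMSEQ_unique[OF induced_start_prob_lim[OF s u]])
  note step = fin_paths_lattice_step[OF u]
  have "start_prob (s n) (u @ [lattice_step (last u) True])
      + start_prob (s n) (u @ [lattice_step (last u) False]) = start_prob (s n) u"
    if "length u \<le> n" for n
  proof -
    have "fst (s n) + snd (s n) = n"
      using s by (intro inf_path_level) (simp add: regular_path_def)
    moreover obtain h t where "last u = (h, t)" by (cases "last u")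
    ultimately show ?thesis
      using extension_weight_split[OF u, of h t "s n" w] length_fin_path[OF u] that
      by (simp add: elementary_start_prob_eq add_divide_distrib lattice_step_def)
  qed
  then have "\<forall>\<^sub>F n in sequentially. start_prob (s n) (u @ [lattice_step (last u) True])
      + start_prob (s n) (u @ [lattice_step (last u) False]) = start_prob (s n) u"
    by (rule eventually_mono[OF eventually_ge_at_top[of "length u"]])
  with tendsto_add[OF induced_start_prob_lim[OF s step[of True]] induced_start_prob_lim[OF s step[of False]]]
  show "(\<lambda>n. start_prob (s n) u) \<longlonglongrightarrow> induced_start_prob s (u @ [lattice_step (last u) True])
    + induced_start_prob s (u @ [lattice_step (last u) False])"
    by (rule Lim_transform_eventually)
qed

lemma induced_start_prob_proportional:
  assumes s: "regular_path w s" and u: "u \<in> fin_paths" "u' \<in> fin_paths" "last u = last u'"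
  shows "path_weight w u' * induced_start_prob s u = path_weight w u * induced_start_prob s u'"
proof (rule LIMSEQ_unique)
  show "(\<lambda>n. path_weight w u' * start_prob (s n) u) \<longlonglongrightarrow> path_weight w u' * induced_start_prob s u"
    by (intro tendsto_intros induced_start_prob_lim s u)
  have "path_weight w u' * start_prob v u = path_weight w u * start_prob v u'" for v
    using extension_weight_proportional[OF u, of w v] by (simp add: elementary_start_prob_eq)
  then show "(\<lambda>n. path_weight w u' * start_prob (s n) u) \<longlonglongrightarrow> path_weight w u * induced_start_prob s u'"
    by (simp only:) (intro tendsto_intros induced_start_prob_lim s u)
qed

text \<open>The limits of the start probabilities are consistent, so a law with these cylinder
  probabilities exists. Their proportionality to path weights, for paths with a common endpoint,
  yields the conditioning property.\<close>

lemma regular_path_induces_law: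
  assumes s: "regular_path w s"
  obtains P where "P \<in> ext_circ w" "induces w s P"
proof -
  let ?F = "induced_start_prob s"
  have F0: "?F [(0, 0)] = 1"
    by (simp add: induced_start_prob_def start_prob_origin)
  have nonneg: "0 \<le> ?F u" if "u \<in> fin_paths" for u
    using LIMSEQ_le_const[OF induced_start_prob_lim[OF s that]] start_prob_nonneg by blast
  obtain P where P: "P \<in> path_laws"
    and prob: "\<And>u. u \<in> fin_paths \<Longrightarrow> \<P>(s in P. starts_with s u) = ?F u"
    by (rule path_law_exists[of ?F, OF F0 nonneg induced_start_prob_split[OF s]]) blast+
  interpret prob_space P using P by (simp add: path_laws_def)
  have sets: "cylinder u \<in> sets P" for u
    using P cylinder_sets by (simp add: path_laws_def)
  have "P \<in> conditioned_laws w"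
    unfolding conditioned_laws_def
  proof (intro CollectI conjI P allI impI ballI)
    fix h t u
    assume pos: "0 < \<P>(s in P. s (h + t) = (h, t))" and u: "u \<in> paths_to (h, t)"
    have "{s \<in> space P. s (h + t) = (h, t)} = (\<Union>u'\<in>paths_to (h, t). cylinder u')"
      unfolding path_law_space[OF P] cylinder_def
      using coordinate_eq_cylinders[of _ "h + t" "(h, t)"] length_paths_to[of _ "(h, t)"]
      by fastforce
    moreover have "disjoint_family_on cylinder (paths_to (h, t))"
      using length_paths_to[of _ "(h, t)"] starts_with_same_length
      by (fastforce simp: disjoint_family_on_def cylinder_def)
    ultimately have "\<P>(s in P. s (h + t) = (h, t)) = (\<Sum>u'\<in>paths_to (h, t). measure P (cylinder u'))"
      using sets by (simp add: finite_measure_finite_Union image_subset_iff)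
    \<comment> \<open>All cylinders over paths to \<open>(h, t)\<close> have the same ratio of
      probability to path weight, so the sum collapses to this ratio times
      \<open>total_weight\<close>.\<close>
    also have "\<dots> = (\<Sum>u'\<in>paths_to (h, t). ?F u / path_weight w u * path_weight w u')"
    proof (rule sum.cong[OF refl])
      fix u' assume u': "u' \<in> paths_to (h, t)"
      have "path_weight w u > 0" using u path_weight_pos by (simp add: paths_to_iff)
      moreover have "path_weight w u' * ?F u = path_weight w u * ?F u'"
        using u u' by (intro induced_start_prob_proportional[OF s]) (simp_all add: paths_to_iff)
      ultimately show "measure P (cylinder u') = ?F u / path_weight w u * path_weight w u'"
        using prob[of u'] u' by (simp add: path_law_starts_with[OF P] paths_to_iff field_simps)
    qed
    also have "\<dots> = ?F u / path_weight w u * total_weight w (h, t)"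
      by (simp add: total_weight_def sum_distrib_left)
    finally have level: "\<P>(s in P. s (h + t) = (h, t)) = ?F u / path_weight w u * total_weight w (h, t)" .
    have "starts_with r u \<and> r (h + t) = (h, t) \<longleftrightarrow> starts_with r u" if "r \<in> inf_paths" for r
      using coordinate_eq_cylinders[OF that, of "h + t" "(h, t)"] length_paths_to[OF u] u by auto
    then have "{r \<in> space P. starts_with r u \<and> r (h + t) = (h, t)} = {r \<in> space P. starts_with r u}"
      unfolding path_law_space[OF P] by blast
    then have "\<P>(s in P. starts_with s u \<bar> s (h + t) = (h, t))
        = ?F u / (?F u / path_weight w u * total_weight w (h, t))"
      unfolding cond_prob_def level using prob[of u] u by (simp add: paths_to_iff)
    moreover have "?F u \<noteq> 0" using pos level by auto
    ultimately show "\<P>(s in P. starts_with s u \<bar> s (h + t) = (h, t))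
        = path_weight w u / total_weight w (h, t)"
      by simp
  qed
  moreover have "induces w s P"
    unfolding induces_def using prob induced_start_prob_lim[OF s] by simp
  ultimately show ?thesis using that s by (auto simp: ext_circ_def)
qed

lemma ext_circ_path_laws: "P \<in> ext_circ w \<Longrightarrow> P \<in> path_laws"
  by (simp add: ext_circ_def conditioned_laws_def)

lemma ext_circ_inducing_path:
  assumes "P \<in> ext_circ w"
  obtains s where "regular_path w s" "s \<in> inf_paths" "induces w s P"
    "(\<lambda>n. head_prob (s n)) \<longlonglongrightarrow> first_step_prob P"
proof -
  obtain s where s: "regular_path w s" "induces w s P"
    using assms by (auto simp: ext_circ_def)
  moreover have "s \<in> inf_paths" using s(1) by (simp add: regular_path_def)
  moreover have "(\<lambda>n. head_prob (s n)) \<longlonglongrightarrow> first_step_prob P"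
    unfolding first_step_prob_eq[OF ext_circ_path_laws[OF assms]]
    using s(2) head_path(1) by (simp add: induces_def)
  ultimately show ?thesis using that by blast
qed

lemma first_step_prob_image: "first_step_prob ` ext_circ w = head_limits"
proof
  show "first_step_prob ` ext_circ w \<subseteq> head_limits"
    by (auto simp: head_limits_def elim: ext_circ_inducing_path)
  show "head_limits \<subseteq> first_step_prob ` ext_circ w"
  proof
    fix x assume "x \<in> head_limits"
    then obtain s where s: "regular_path w s" and x: "(\<lambda>n. head_prob (s n)) \<longlonglongrightarrow> x"
      by (auto simp: head_limits_def)
    obtain P where P: "P \<in> ext_circ w" "induces w s P"
      using regular_path_induces_law[OF s] .
    have "(\<lambda>n. head_prob (s n)) \<longlonglongrightarrow> first_step_prob P"
      unfolding first_step_prob_eq[OF ext_circ_path_laws[OF P(1)]]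
      using P(2) head_path(1) by (simp add: induces_def)
    then have "x = first_step_prob P" using x LIMSEQ_unique by blast
    then show "x \<in> first_step_prob ` ext_circ w" using P(1) by blast
  qed
qed

text \<open>The bound along two inducing paths survives the limit. As \<open>L\<close> depends only
  on \<open>u\<close>, this gives both injectivity of \<open>first_step_prob\<close> and continuity
  of its inverse.\<close>

lemma ext_circ_lipschitz:
  assumes "u \<in> fin_paths"
  obtains L where "0 \<le> L"
    and "\<And>P P'. P \<in> ext_circ w \<Longrightarrow> P' \<in> ext_circ w \<Longrightarrow>
      \<bar>\<P>(s in P. starts_with s u) - \<P>(s in P'. starts_with s u)\<bar>
        \<le> L * \<bar>first_step_prob P - first_step_prob P'\<bar>"
proof -
  obtain L where L: "0 \<le> L"
    and le: "\<And>s s'. s \<in> inf_paths \<Longrightarrow> s' \<in> inf_paths \<Longrightarrow>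
      \<forall>\<^sub>F n in sequentially. \<bar>start_prob (s n) u - start_prob (s' n) u\<bar>
        \<le> L * \<bar>head_prob (s n) - head_prob (s' n)\<bar>"
    by (rule start_prob_lipschitz_paths[of u]) blast
  show ?thesis
  proof (rule that[OF L])
    fix P P' assume P: "P \<in> ext_circ w" "P' \<in> ext_circ w"
    obtain s where s: "s \<in> inf_paths" "induces w s P" "(\<lambda>n. head_prob (s n)) \<longlonglongrightarrow> first_step_prob P"
      using ext_circ_inducing_path[OF P(1)] by blast
    obtain s' where s': "s' \<in> inf_paths" "induces w s' P'" "(\<lambda>n. head_prob (s' n)) \<longlonglongrightarrow> first_step_prob P'"
      using ext_circ_inducing_path[OF P(2)] by blast
    have lim: "(\<lambda>n. start_prob (s n) u) \<longlonglongrightarrow> \<P>(s in P. starts_with s u)"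
      "(\<lambda>n. start_prob (s' n) u) \<longlonglongrightarrow> \<P>(s in P'. starts_with s u)"
      using s(2) s'(2) assms by (simp_all add: induces_def)
    show "\<bar>\<P>(s in P. starts_with s u) - \<P>(s in P'. starts_with s u)\<bar>
        \<le> L * \<bar>first_step_prob P - first_step_prob P'\<bar>"
      by (rule tendsto_le[OF sequentially_bot _ _ le[OF s(1) s'(1)]])
        (intro tendsto_intros lim s(3) s'(3))+
  qed
qed

lemma first_step_prob_inj: "inj_on first_step_prob (ext_circ w)"
proof (rule inj_onI)
  fix P P' assume P: "P \<in> ext_circ w" "P' \<in> ext_circ w" and eq: "first_step_prob P = first_step_prob P'"
  have "\<P>(s in P. starts_with s u) = \<P>(s in P'. starts_with s u)" if u: "u \<in> fin_paths" for u
  proof -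
    obtain L where "\<bar>\<P>(s in P. starts_with s u) - \<P>(s in P'. starts_with s u)\<bar>
        \<le> L * \<bar>first_step_prob P - first_step_prob P'\<bar>"
      using P by (auto intro: ext_circ_lipschitz[OF u])
    then show ?thesis using eq by simp
  qed
  then show "P = P'"
    using P by (intro path_law_eqI ext_circ_path_laws)
qed

section \<open>The weak topology\<close>

lemma topspace_weak_topology: "topspace weak_topology = path_laws"
  by (auto simp: weak_topology_def topspace_pullback_topology)

lemma continuous_map_first_step_prob: "continuous_map weak_topology euclideanreal first_step_prob"
proof -
  have "continuous_map weak_topology euclideanreal
      ((\<lambda>f. f [(0, 0), (Suc 0, 0)]) \<circ> (\<lambda>P. \<lambda>u\<in>fin_paths. \<P>(s in P. starts_with s u)))"
    unfolding weak_topology_def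
    by (intro continuous_map_pullback continuous_map_product_projection head_path)
  then show ?thesis
    by (rule continuous_map_eq)
      (use head_path first_step_prob_eq in \<open>simp add: topspace_weak_topology\<close>)
qed

section \<open>Continuity of the inverse, and compactness\<close>

definition law_of :: "real \<Rightarrow> (nat \<Rightarrow> vertex) measure" where
  "law_of = the_inv_into (ext_circ w) first_step_prob"

lemma law_of: "x \<in> head_limits \<Longrightarrow> law_of x \<in> ext_circ w" "x \<in> head_limits \<Longrightarrow> first_step_prob (law_of x) = x"
  unfolding law_of_def first_step_prob_image[symmetric]
  by (auto intro: the_inv_into_into[OF first_step_prob_inj] f_the_inv_into_f[OF first_step_prob_inj])

lemma law_of_first_step_prob: "P \<in> ext_circ w \<Longrightarrow> law_of (first_step_prob P) = P"
  unfolding law_of_def by (rule the_inv_into_f_f[OF first_step_prob_inj])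

text \<open>In the pullback topology it suffices to check one cylinder probability at a time, and
  each is a Lipschitz function of \<open>x\<close>.\<close>

lemma continuous_map_law_of: "continuous_map (top_of_set head_limits) weak_topology law_of"
  unfolding weak_topology_def
proof (rule continuous_map_pullback')
  have "continuous_on head_limits (\<lambda>x. \<P>(s in law_of x. starts_with s u))" if u: "u \<in> fin_paths" for u
  proof -
    obtain L where L: "0 \<le> L"
      and le: "\<And>P P'. P \<in> ext_circ w \<Longrightarrow> P' \<in> ext_circ w \<Longrightarrow>
        \<bar>\<P>(s in P. starts_with s u) - \<P>(s in P'. starts_with s u)\<bar>
          \<le> L * \<bar>first_step_prob P - first_step_prob P'\<bar>"
      by (rule ext_circ_lipschitz[OF u]) blast
    have "L-lipschitz_on head_limits (\<lambda>x. \<P>(s in law_of x. starts_with s u))"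
    proof (rule lipschitz_onI[OF _ L])
      fix x y assume "x \<in> head_limits" "y \<in> head_limits"
      then show "dist \<P>(s in law_of x. starts_with s u) \<P>(s in law_of y. starts_with s u) \<le> L * dist x y"
        using le[of "law_of x" "law_of y"] by (simp add: law_of dist_real_def)
    qed
    then show ?thesis by (rule lipschitz_on_continuous_on)
  qed
  then show "continuous_map (top_of_set head_limits) (product_topology (\<lambda>_. euclideanreal) fin_paths)
      ((\<lambda>P. \<lambda>u\<in>fin_paths. \<P>(s in P. starts_with s u)) \<circ> law_of)"
    by (auto simp: continuous_map_componentwise)
  show "topspace (top_of_set head_limits) \<subseteq> law_of -` path_laws"
    using law_of(1) ext_circ_path_laws by auto
qed

lemma law_of_image: "law_of ` head_limits = ext_circ w"
  using law_of(1) law_of_first_step_prob first_step_prob_image by force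

text \<open>The set is the continuous image under \<open>law_of\<close> of a closed bounded set of
  reals.\<close>

lemma compactin_ext_circ: "compactin weak_topology (ext_circ w)"
proof -
  have "compact head_limits"
    using closed_head_limits head_limits_bounds
    by (metis bounded_closed_interval bounded_subset compact_eq_bounded_closed)
  then have "compactin (top_of_set head_limits) head_limits"
    by (simp add: compactin_subtopology)
  from image_compactin[OF this continuous_map_law_of] show ?thesis
    by (simp add: law_of_image)
qed

lemma homeomorphic_maps_first_step_prob:
  "homeomorphic_maps (subtopology weak_topology (ext_circ w)) (top_of_set head_limits)
     first_step_prob law_of"
proof -
  have "continuous_map (subtopology weak_topology (ext_circ w)) (top_of_set head_limits) first_step_prob"
    using first_step_prob_image
    by (intro continuous_map_into_subtopology continuous_map_from_subtopology
        continuous_map_first_step_prob) auto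
  moreover have "continuous_map (top_of_set head_limits) (subtopology weak_topology (ext_circ w)) law_of"
    using law_of(1) by (auto intro!: continuous_map_into_subtopology continuous_map_law_of)
  ultimately show ?thesis
    using law_of(2) law_of_first_step_prob by (simp add: homeomorphic_maps_def)
qed

end

theorem proposition2:
  fixes w :: "vertex \<times> vertex \<Rightarrow> real"
  assumes "\<And>e. e \<in> lattice_edges \<Longrightarrow> w e > 0"
  shows "compactin weak_topology (ext_circ w)
    \<and> first_step_prob ` ext_circ w \<subseteq> {0..1}
    \<and> homeomorphic_map
         (subtopology weak_topology (ext_circ w))
         (top_of_set (first_step_prob ` ext_circ w))
         first_step_prob"
proof -
  interpret positive_weights w by unfold_locales (rule assms)
  show ?thesis
    using compactin_ext_circ head_limits_bounds homeomorphic_maps_first_step_prob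
    unfolding first_step_prob_image homeomorphic_map_maps by blast
qed

end
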